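(* Let $n\ge 4$ be an even integer, $K$ a field, and $T=K[x_1,\ldots,x_n,y_1,\ldots,y_n]$, with indices of the $x$- and $y$-variables taken modulo $n$ (so $x_0=x_n$, $y_0=y_n$). Let $$f_j=x_{\frac n2+j}y_j-x_jy_{j+1}\quad (j=1,\ldots,n-1),$$ $$g_k=y_k\prod_{i=0}^{k-1}x_i-y_0\prod_{i=\frac n2}^{k-1+\frac n2}x_i\quad (k=1,\ldots,\tfrac n2-1),$$ $$h_l=y_ly_{l+\frac n2}-y_0y_{\frac n2}\quad (l=1,\ldots,\tfrac n2-1).$$ Let $L$ be the defining ideal of the symmetric algebra of $I_{\frac n2}(C_n)$ and let $H=(h_1,\ldots,h_{\frac n2-1})\subset K[y_1,\ldots,y_n]$. Let $<$ be any monomial order on $T$ which is the product order of $<_1$ and $<_2$, where $<_1$ is the reverse lexicographic order on $K[y_1,\ldots,y_n]$ induced by $y_1>y_2>\cdots>y_{n-1}>y_0$, and $<_2$ is an arbitrary monomial order on $K[x_1,\ldots,x_n]$. Then the polynomials $$f_1,\ldots,f_{n-1},\ g_1,\ldots,g_{\frac n2-1},\ h_1,\ldots,h_{\frac n2-1}$$ form a Gröbner basis of $L+HT$ with respect to $<$.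
   Context: Let $S=K[x_1,\ldots,x_n]$. $I_{\frac n2}(C_n)\subset S$ is the $\frac n2$-path ideal of the $n$-cycle, generated by the monomials $u_j=x_jx_{j+1}\cdots x_{j+\frac n2-1}$, $j=1,\ldots,n$ (indices modulo $n$). The defining ideal $L\subset T=S[y_1,\ldots,y_n]$ of the symmetric algebra of $I_{\frac n2}(C_n)$ is the ideal generated by all $\sum_i a_iy_i$ with $a_i\in S$ and $\sum_i a_iu_i=0$; it is known (Brumatti–da Silva) that $L=(f_1,\ldots,f_{n-1},g_1)$. The reverse lexicographic order is the usual graded one: monomials are compared first by degree, ties broken reverse lexicographically. The product order of $<_1$ and $<_2$ compares the $y$-parts first: for monomials $u,u'$ in the $x$'s and $v,v'$ in the $y$'s, $uv<u'v'$ iff $v<_1v'$, or $v=v'$ and $u<_2u'$. *)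

theory Defs
  imports
    "HOL-Library.Poly_Mapping"
    "Berlekamp_Zassenhaus.Finite_Field"
begin

section \<open>Polynomials, monomial orders, Groebner bases\<close>

text \<open>
  A monomial in variables \<open>'v\<close> is its exponent vector \<open>'v \<Rightarrow>\<^sub>0 nat\<close> (written additively, so
  the monomial 1 is \<open>0\<close>), and a polynomial is a finitely supported map from monomials to
  coefficients; its multiplication is the convolution product of \<open>Poly_Mapping\<close>.
\<close>

type_synonym ('v, 'k) mpoly = "('v \<Rightarrow>\<^sub>0 nat) \<Rightarrow>\<^sub>0 'k"

definition monom_poly :: "('v \<Rightarrow>\<^sub>0 nat) \<Rightarrow> ('v, 'k::comm_ring_1) mpoly" where
  "monom_poly m = Poly_Mapping.single m 1"

definition Var :: "'v \<Rightarrow> ('v, 'k::comm_ring_1) mpoly" where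
  "Var v = monom_poly (Poly_Mapping.single v 1)"

text \<open>The subring \<open>K[V]\<close> of polynomials involving only the variables in \<open>V\<close>.\<close>

definition poly_ring :: "'v set \<Rightarrow> ('v, 'k::comm_ring_1) mpoly set" where
  "poly_ring V = {p. \<forall>m \<in> Poly_Mapping.keys p. Poly_Mapping.keys m \<subseteq> V}"

text \<open>The ideal generated by a set: the span in the ring regarded as a module over itself.\<close>

abbreviation ideal_gen :: "'r::comm_ring_1 set \<Rightarrow> 'r set" where
  "ideal_gen \<equiv> Modules.module.span (*)"

lemma module_times: "Modules.module ((*) :: 'r::comm_ring_1 \<Rightarrow> 'r \<Rightarrow> 'r)"
  by unfold_locales (auto simp: algebra_simps)

text \<open>Strict total orders; well-foundedness is automatic for finitely many variables (Dickson).\<close>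

definition monomial_order :: "(('v \<Rightarrow>\<^sub>0 nat) \<Rightarrow> ('v \<Rightarrow>\<^sub>0 nat) \<Rightarrow> bool) \<Rightarrow> bool" where
  "monomial_order lt \<longleftrightarrow>
     irreflp lt \<and> transp lt \<and> totalp lt \<and>
     (\<forall>u. u \<noteq> 0 \<longrightarrow> lt 0 u) \<and>
     (\<forall>u v w. lt u v \<longrightarrow> lt (u + w) (v + w))"

definition lead_monom ::
  "(('v \<Rightarrow>\<^sub>0 nat) \<Rightarrow> ('v \<Rightarrow>\<^sub>0 nat) \<Rightarrow> bool) \<Rightarrow> ('v, 'k::comm_ring_1) mpoly \<Rightarrow> ('v \<Rightarrow>\<^sub>0 nat)" where
  "lead_monom lt p = (THE m. m \<in> Poly_Mapping.keys p \<and>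
     (\<forall>m' \<in> Poly_Mapping.keys p. m' \<noteq> m \<longrightarrow> lt m' m))"

definition initial_ideal ::
  "(('v \<Rightarrow>\<^sub>0 nat) \<Rightarrow> ('v \<Rightarrow>\<^sub>0 nat) \<Rightarrow> bool) \<Rightarrow> ('v, 'k::comm_ring_1) mpoly set
    \<Rightarrow> ('v, 'k) mpoly set" where
  "initial_ideal lt I = ideal_gen {monom_poly (lead_monom lt p) | p. p \<in> I \<and> p \<noteq> 0}"

definition is_groebner_basis ::
  "(('v \<Rightarrow>\<^sub>0 nat) \<Rightarrow> ('v \<Rightarrow>\<^sub>0 nat) \<Rightarrow> bool) \<Rightarrow> ('v, 'k::comm_ring_1) mpoly set
    \<Rightarrow> ('v, 'k) mpoly set \<Rightarrow> bool" where
  "is_groebner_basis lt G I \<longleftrightarrow>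
     finite G \<and> 0 \<notin> G \<and> G \<subseteq> I \<and>
     initial_ideal lt I = ideal_gen {monom_poly (lead_monom lt p) | p. p \<in> G}"


section \<open>The ring $T$ and its monomial orders\<close>

datatype 'i xy_var = X 'i | Y 'i

text \<open>
  Indices modulo \<open>n\<close> are elements of \<open>'n mod_ring\<close>, i.e. of $\mathbb{Z}/n\mathbb{Z}$ with
  \<open>n = CARD('n)\<close>.
\<close>

type_synonym ('n, 'k) T = "('n mod_ring xy_var, 'k) mpoly"

definition x_var :: "nat \<Rightarrow> ('n::nontriv, 'k::field) T" where
  "x_var j = Var (X (of_nat j))"

definition y_var :: "nat \<Rightarrow> ('n::nontriv, 'k::field) T" where
  "y_var j = Var (Y (of_nat j))"

text \<open>
  The two parts of a monomial of \<open>T\<close>: since \<open>X\<close> and \<open>Y\<close> are injective, \<open>map_key X m\<close> has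
  exponent \<open>lookup m (X i)\<close> at \<open>i\<close>, and similarly for \<open>Y\<close>.
\<close>

definition product_order ::
  "(('i \<Rightarrow>\<^sub>0 nat) \<Rightarrow> ('i \<Rightarrow>\<^sub>0 nat) \<Rightarrow> bool) \<Rightarrow> (('i \<Rightarrow>\<^sub>0 nat) \<Rightarrow> ('i \<Rightarrow>\<^sub>0 nat) \<Rightarrow> bool)
    \<Rightarrow> ('i xy_var \<Rightarrow>\<^sub>0 nat) \<Rightarrow> ('i xy_var \<Rightarrow>\<^sub>0 nat) \<Rightarrow> bool" where
  "product_order lt1 lt2 m m' \<longleftrightarrow>
     lt1 (Poly_Mapping.map_key Y m) (Poly_Mapping.map_key Y m') \<or>
     Poly_Mapping.map_key Y m = Poly_Mapping.map_key Y m' \<and>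
     lt2 (Poly_Mapping.map_key X m) (Poly_Mapping.map_key X m')"

definition monom_degree :: "('i::finite \<Rightarrow>\<^sub>0 nat) \<Rightarrow> nat" where
  "monom_degree a = (\<Sum>i\<in>UNIV. Poly_Mapping.lookup a i)"

text \<open>
  Graded reverse lexicographic order for $y_1 > y_2 > \dots > y_{n-1} > y_n = y_0$: in equal
  degree, \<open>a\<close> is smaller iff \<open>a\<close> has the larger exponent at the last position where
  the two differ.
\<close>

definition revlex ::
  "('n::nontriv mod_ring \<Rightarrow>\<^sub>0 nat) \<Rightarrow> ('n mod_ring \<Rightarrow>\<^sub>0 nat) \<Rightarrow> bool" where
  "revlex a b \<longleftrightarrow>
     monom_degree a < monom_degree b \<or>
     monom_degree a = monom_degree b \<and>
     (\<exists>j \<in> {1..CARD('n)}.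
        Poly_Mapping.lookup a (of_nat j) > Poly_Mapping.lookup b (of_nat j) \<and>
        (\<forall>i \<in> {j<..CARD('n)}.
           Poly_Mapping.lookup a (of_nat i) = Poly_Mapping.lookup b (of_nat i)))"


section \<open>The path ideal, its symmetric algebra, and the polynomials $f$, $g$, $h$\<close>

definition path_gen :: "nat \<Rightarrow> ('n::nontriv, 'k::field) T" where
  "path_gen j = (\<Prod>i = j..j + CARD('n) div 2 - 1. x_var i)"

text \<open>
  The defining ideal in \<open>T = S[y\<^sub>1, \<dots>, y\<^sub>n]\<close> of the symmetric algebra of the ideal of
  \<open>S = K[x\<^sub>1, \<dots>, x\<^sub>n]\<close> generated by \<open>u\<^sub>1, \<dots>, u\<^sub>n\<close>; here \<open>S\<close> is viewed as a subring of \<open>T\<close>.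
\<close>

definition sym_ideal :: "(nat \<Rightarrow> ('n::nontriv, 'k::field) T) \<Rightarrow> ('n, 'k) T set" where
  "sym_ideal u = ideal_gen
     {\<Sum>i = 1..CARD('n). a i * y_var i | a.
        (\<forall>i \<in> {1..CARD('n)}. a i \<in> poly_ring (range X)) \<and>
        (\<Sum>i = 1..CARD('n). a i * u i) = 0}"

definition L_ideal :: "('n::nontriv, 'k::field) T set" where
  "L_ideal = sym_ideal path_gen"

definition f_poly :: "nat \<Rightarrow> ('n::nontriv, 'k::field) T" where
  "f_poly j = x_var (CARD('n) div 2 + j) * y_var j - x_var j * y_var (j + 1)"

definition g_poly :: "nat \<Rightarrow> ('n::nontriv, 'k::field) T" where
  "g_poly k = y_var k * (\<Prod>i = 0..k - 1. x_var i)
       - y_var 0 * (\<Prod>i = CARD('n) div 2..k - 1 + CARD('n) div 2. x_var i)"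

definition h_poly :: "nat \<Rightarrow> ('n::nontriv, 'k::field) T" where
  "h_poly l = y_var l * y_var (l + CARD('n) div 2) - y_var 0 * y_var (CARD('n) div 2)"

text \<open>\<open>H_ideal\<close> is an ideal of the subring \<open>K[y\<^sub>1, \<dots>, y\<^sub>n]\<close>, so its coefficients lie in that subring.\<close>

definition H_ideal :: "('n::nontriv, 'k::field) T set" where
  "H_ideal = {\<Sum>l = 1..CARD('n) div 2 - 1. c l * h_poly l | c.
          \<forall>l \<in> {1..CARD('n) div 2 - 1}. c l \<in> poly_ring (range Y)}"

definition HT_ideal :: "('n::nontriv, 'k::field) T set" where
  "HT_ideal = ideal_gen H_ideal"

end

theory Submission
  imports Defs
begin

text \<open>
  Put \<open>m = n / 2\<close>. The Rees map sends \<open>x\<^sub>i\<close> to \<open>x\<^sub>i\<close> and \<open>y\<^sub>j\<close> to \<open>u\<^sub>j t\<close>. Its kernel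
  contains \<open>L\<close>, because a generator \<open>\<Sum> a\<^sub>i y\<^sub>i\<close> of \<open>L\<close> goes to \<open>t \<Sum> a\<^sub>i u\<^sub>i = 0\<close>, and it contains
  every \<open>h\<^sub>l\<close>, because the two paths starting at the opposite vertices \<open>l\<close> and \<open>l + m\<close> cover the
  cycle exactly once, so that the product of their monomials is the same for all \<open>l\<close>. The polynomials \<open>f\<close>, \<open>g\<close>, \<open>h\<close>, which are differences of
  two monomials, lie in \<open>L + HT\<close>. Thus \<open>L + HT\<close> is caught between the given set and the kernel of a
  map that sends monomials to monomials.

  In such a situation the set is a Groebner basis as soon as two standard monomials (monomials
  divisible by no leading monomial of the set) with the same image are equal; this is
  \<open>groebner_basis_by_fibres\<close>. Indeed, replacing a leading monomial by the other monomial of its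
  binomial gives a smaller monomial in the same fibre, so the least element of a fibre is standard,
  and by uniqueness standard monomials are exactly these least elements. If \<open>p \<noteq> 0\<close> lies in the
  kernel, its leading monomial shares its fibre with another, smaller monomial of \<open>p\<close>, so it is not
  standard.

  Uniqueness is the combinatorial statement \<open>reduced_exponents_unique\<close>. For a monomial
  \<open>x\<^sup>a y\<^sup>b\<close> let \<open>s i\<close> be the sum of \<open>b\<close> over the \<open>m\<close> consecutive indices ending at \<open>i\<close>. The image of
  the monomial records the numbers \<open>a i + s i\<close> and the total \<open>B\<close> of \<open>b\<close>. Since
  \<open>s i + s (i + m) = B\<close>, every fibre prescribes for each \<open>s i\<close> a lower bound, attained iff
  \<open>a (i + m) = 0\<close>, and an upper bound, attained iff \<open>a i = 0\<close>. Now
  \<open>s l - s (l - 1) = b l - b (l + m)\<close>, and for a standard monomial the \<open>h\<^sub>l\<close> make one of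
  the two terms vanish, while the \<open>f\<^sub>j\<close> allow \<open>s\<close> to rise only to its lower bound and to fall only to
  its upper bound. So \<open>s l\<close> is \<open>s (l - 1)\<close> clamped to the interval given by the bounds, and
  \<open>s 0\<close> determines the sequence. Suppose that a second standard monomial of the fibre has
  \<open>s 0 < s' 0\<close>. As long as \<open>s < s'\<close>, the sequence \<open>s\<close> is below its upper bound, so by the \<open>g\<^sub>k\<close> it does
  not rise; once the sequences meet they coincide. Hence
  \<open>s 0 + b 1 + \<dots> + b (m - 1) < s' 0 + b' 1 + \<dots> + b' (m - 1)\<close>. But adding \<open>b m\<close> on the left and
  \<open>b' m\<close> on the right gives \<open>B\<close> on both sides, and \<open>b m = 0\<close> because of \<open>f\<^sub>m\<close> and \<open>a 0 > 0\<close>.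
\<close>

section \<open>Window sums of periodic sequences\<close>

text \<open>
  For \<open>b\<close> of period \<open>2 m\<close> this is the sum of \<open>b\<close> over the \<open>m\<close> indices from \<open>i - m + 1\<close> to \<open>i\<close>.
  Shifting the indices by the period keeps them natural numbers.
\<close>
definition window :: "nat \<Rightarrow> (nat \<Rightarrow> nat) \<Rightarrow> nat \<Rightarrow> nat" where
  "window m b i = (\<Sum>r<m. b (i + m + 1 + r))"

lemma window_step:
  assumes per: "\<forall>i. b (i + 2 * m) = b i"
  shows "window m b (Suc i) + b (m + Suc i) = window m b i + b (Suc i)"
proof -
  have "window m b i + b (Suc i) = (\<Sum>r<m. b (i + m + 1 + r)) + b (Suc i + 2 * m)"
    using per[rule_format, of "Suc i"] by (simp add: window_def)
  also have "\<dots> = (\<Sum>r<Suc m. b (i + m + 1 + r))"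
    by (simp add: algebra_simps mult_2_right)
  also have "\<dots> = b (m + Suc i) + window m b (Suc i)"
    by (subst sum.lessThan_Suc_shift) (simp add: window_def algebra_simps)
  finally show ?thesis by simp
qed

text \<open>
  The windows ending at \<open>i\<close> and at \<open>m + i\<close> partition one period. Moving both by one step exchanges
  the same two entries, so their sum does not depend on \<open>i\<close>.
\<close>
lemma window_opposite:
  assumes per: "\<forall>i. b (i + 2 * m) = b i"
  shows "window m b i + window m b (m + i) = (\<Sum>j=1..2*m. b j)"
proof (induction i)
  case 0
  have split: "(\<Sum>j=1..2*m. b j) = (\<Sum>r<2*m. b (Suc r))"
    by (rule sum.reindex_bij_witness[of _ Suc "\<lambda>j. j - 1"]) auto
  have "(\<Sum>r<m + k. b (Suc r)) = (\<Sum>r<m. b (Suc r)) + (\<Sum>r<k. b (Suc (m + r)))" for k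
    by (induction k) (auto simp: algebra_simps)
  from this[of m] have "(\<Sum>r<2*m. b (Suc r)) = (\<Sum>r<m. b (Suc r)) + window m b 0"
    by (simp add: window_def mult_2)
  moreover have "window m b m = (\<Sum>r<m. b (Suc r))"
    unfolding window_def
    by (rule sum.cong) (use per[rule_format, of "Suc _"] in \<open>auto simp: algebra_simps mult_2_right\<close>)
  ultimately show ?case using split by simp
next
  case (Suc i)
  have "b (m + Suc (m + i)) = b (Suc i)"
    using per[rule_format, of "Suc i"] by (simp add: algebra_simps mult_2_right)
  then show ?case
    using Suc window_step[of b m i, OF per] window_step[of b m "m + i", OF per] by simp
qed

text \<open>
  The exponents \<open>a\<close> of the \<open>x\<^sub>i\<close> and \<open>b\<close> of the \<open>y\<^sub>j\<close> in a monomial divisible by no leading monomial.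
  The first three conditions come from the \<open>f\<^sub>j\<close> with \<open>j < m\<close>, \<open>j = m\<close> and \<open>j > m\<close>, the fourth from
  the \<open>g\<^sub>k\<close> and the fifth from the \<open>h\<^sub>l\<close>.
\<close>
definition reduced_exponents :: "nat \<Rightarrow> (nat \<Rightarrow> nat) \<Rightarrow> (nat \<Rightarrow> nat) \<Rightarrow> bool" where
  "reduced_exponents m a b \<longleftrightarrow>
     (\<forall>j\<in>{1..<m}. b j > 0 \<longrightarrow> a (m + j) = 0) \<and>
     (b m > 0 \<longrightarrow> a 0 = 0) \<and>
     (\<forall>j\<in>{1..<m}. b (m + j) > 0 \<longrightarrow> a j = 0) \<and>
     (\<forall>k\<in>{1..<m}. b k > 0 \<longrightarrow> (\<exists>i<k. a i = 0)) \<and>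
     (\<forall>l\<in>{1..<m}. b l = 0 \<or> b (m + l) = 0)"

text \<open>
  Two monomials with the same image under the Rees map: \<open>a i + window m b i\<close> is the exponent of
  \<open>x\<^sub>i\<close> in the image and the total of \<open>b\<close> is the exponent of \<open>t\<close>.
\<close>
definition same_image ::
  "nat \<Rightarrow> (nat \<Rightarrow> nat) \<Rightarrow> (nat \<Rightarrow> nat) \<Rightarrow> (nat \<Rightarrow> nat) \<Rightarrow> (nat \<Rightarrow> nat) \<Rightarrow> bool" where
  "same_image m a b a' b' \<longleftrightarrow>
     (\<forall>i. b (i + 2 * m) = b i) \<and> (\<forall>i. b' (i + 2 * m) = b' i) \<and>
     (\<forall>i<2*m. a i + window m b i = a' i + window m b' i) \<and>
     (\<Sum>j=1..2*m. b j) = (\<Sum>j=1..2*m. b' j)"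

lemma reduced_exponents_opposite:
  "reduced_exponents m a b \<Longrightarrow> l \<in> {1..<m} \<Longrightarrow> b l = 0 \<or> b (m + l) = 0"
  by (simp add: reduced_exponents_def)

lemma same_image_sym: "same_image m a b a' b' \<Longrightarrow> same_image m a' b' a b"
  by (auto simp: same_image_def)

text \<open>
  Clamping to an interval is monotone. If the order of the windows flipped at \<open>Suc l\<close>, the
  window of \<open>b\<close> would be above its lower bound there, so it did not rise, and that of \<open>b'\<close> below
  its upper bound, so it did not fall.
\<close>
lemma window_mono_step:
  assumes same: "same_image m a b a' b'"
    and red: "reduced_exponents m a b" "reduced_exponents m a' b'"
    and l: "Suc l < m" and le: "window m b l \<le> window m b' l"
  shows "window m b (Suc l) \<le> window m b' (Suc l)"
proof (rule ccontr)
  assume "\<not> ?thesis"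
  then have gt: "window m b' (Suc l) < window m b (Suc l)" by simp
  have per: "\<forall>i. b (i + 2 * m) = b i" "\<forall>i. b' (i + 2 * m) = b' i"
    using same by (auto simp: same_image_def)
  have eq: "a (Suc l) + window m b (Suc l) = a' (Suc l) + window m b' (Suc l)"
    "a (m + Suc l) + window m b (m + Suc l) = a' (m + Suc l) + window m b' (m + Suc l)"
    using same l by (auto simp: same_image_def)
  have opp: "window m b (Suc l) + window m b (m + Suc l)
      = window m b' (Suc l) + window m b' (m + Suc l)"
    using window_opposite[OF per(1), of "Suc l"] window_opposite[OF per(2), of "Suc l"] same
    by (simp add: same_image_def)
  have "a' (Suc l) > 0" using eq(1) gt by linarith
  then have b': "b' (m + Suc l) = 0"
    using red(2) l unfolding reduced_exponents_def
    by (metis atLeastLessThan_iff gr0I le_add1 plus_1_eq_Suc not_less_zero)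
  have "a (m + Suc l) > 0" using eq(2) opp gt by linarith
  then have b: "b (Suc l) = 0"
    using red(1) l unfolding reduced_exponents_def
    by (metis atLeastLessThan_iff gr0I le_add1 plus_1_eq_Suc not_less_zero)
  show False
    using window_step[OF per(1), of l] window_step[OF per(2), of l] b b' gt le by linarith
qed

lemma window_eq_step:
  assumes same: "same_image m a b a' b'"
    and red: "reduced_exponents m a b" "reduced_exponents m a' b'"
    and l: "Suc l < m" and eq: "window m b l = window m b' l"
  shows "window m b (Suc l) = window m b' (Suc l)"
    and "b (Suc l) = b' (Suc l)"
    and "b (m + Suc l) = b' (m + Suc l)"
proof -
  show w: "window m b (Suc l) = window m b' (Suc l)"
    using window_mono_step[OF same red l] window_mono_step[OF same_image_sym[OF same] red(2,1) l] eq
    by simp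
  have per: "\<forall>i. b (i + 2 * m) = b i" "\<forall>i. b' (i + 2 * m) = b' i"
    using same by (auto simp: same_image_def)
  have "Suc l \<in> {1..<m}" using l by simp
  from reduced_exponents_opposite[OF red(1) this] reduced_exponents_opposite[OF red(2) this]
  show "b (Suc l) = b' (Suc l)" "b (m + Suc l) = b' (m + Suc l)"
    using window_step[OF per(1), of l] window_step[OF per(2), of l] eq w by linarith+
qed

text \<open>
  The windows ending at \<open>0\<close> and at \<open>m\<close> partition one period, and the latter consists of the indices
  from \<open>1\<close> to \<open>m\<close>.
\<close>
lemma window_zero_rise:
  assumes per: "\<forall>i. b (i + 2 * m) = b i" and m: "m > 0"
  shows "window m b 0 + (\<Sum>k=1..m-1. b k) + b m = (\<Sum>j=1..2*m. b j)"
proof -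
  have "window m b m = (\<Sum>r<m. b (Suc r))"
    unfolding window_def
    by (rule sum.cong) (use per[rule_format, of "Suc _"] in \<open>auto simp: algebra_simps mult_2_right\<close>)
  also have "\<dots> = (\<Sum>k=1..m. b k)"
    by (rule sum.reindex_bij_witness[of _ "\<lambda>j. j - 1" Suc]) auto
  also have "\<dots> = (\<Sum>k=1..m-1. b k) + b m"
    using m by (cases m) auto
  finally show ?thesis using window_opposite[OF per, of 0] by simp
qed

text \<open>
  The windows of \<open>b\<close> stay strictly below those of \<open>b'\<close> until the two meet, and until then all
  \<open>a i\<close> are positive, so the fourth condition of reducedness keeps \<open>b\<close> zero; afterwards the entries
  agree. The total then forces \<open>b' m < b m\<close>, although \<open>b m = 0\<close>.
\<close>
lemma window_zero_not_less:
  assumes same: "same_image m a b a' b'"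
    and red: "reduced_exponents m a b" "reduced_exponents m a' b'"
    and m: "m > 0"
  shows "\<not> window m b 0 < window m b' 0"
proof
  assume lt: "window m b 0 < window m b' 0"
  have per: "\<forall>i. b (i + 2 * m) = b i" "\<forall>i. b' (i + 2 * m) = b' i"
    using same by (auto simp: same_image_def)
  have pos: "a i > 0" if "i < m" "window m b i < window m b' i" for i
  proof -
    have "a i + window m b i = a' i + window m b' i"
      using same that by (simp add: same_image_def)
    then show ?thesis using that by linarith
  qed
  have key: "window m b 0 + (\<Sum>k=1..l. b k) < window m b' 0 + (\<Sum>k=1..l. b' k) \<and>
      ((\<forall>i\<le>l. window m b i < window m b' i) \<or> window m b l = window m b' l)" if "l < m" for l
    using that
  proof (induction l)
    case 0
    then show ?case using lt by simp
  next
    case (Suc l)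
    then have IH: "window m b 0 + (\<Sum>k=1..l. b k) < window m b' 0 + (\<Sum>k=1..l. b' k)"
      and cases: "(\<forall>i\<le>l. window m b i < window m b' i) \<or> window m b l = window m b' l"
      by auto
    from cases show ?case
    proof
      assume less: "\<forall>i\<le>l. window m b i < window m b' i"
      then have "\<forall>i<Suc l. a i \<noteq> 0"
        using pos Suc.prems by (metis Suc_lessD less_Suc_eq_le less_trans neq0_conv)
      moreover have "Suc l \<in> {1..<m}" using Suc.prems by simp
      ultimately have "b (Suc l) = 0"
        using red(1) unfolding reduced_exponents_def by (metis neq0_conv)
      moreover have "window m b (Suc l) \<le> window m b' (Suc l)"
        using window_mono_step[OF same red Suc.prems] less by (simp add: less_imp_le)
      ultimately show ?thesis using IH less by (auto simp: le_Suc_eq)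
    next
      assume "window m b l = window m b' l"
      from window_eq_step[OF same red Suc.prems this] show ?thesis using IH by simp
    qed
  qed
  have "a 0 > 0" using pos lt m by simp
  then have "b m = 0" using red(1) by (auto simp: reduced_exponents_def)
  moreover have "(\<Sum>j=1..2*m. b j) = (\<Sum>j=1..2*m. b' j)"
    using same by (simp add: same_image_def)
  ultimately show False
    using key[of "m - 1"] window_zero_rise[OF per(1) m] window_zero_rise[OF per(2) m] m by linarith
qed

text \<open>
  Equal windows at \<open>0\<close> propagate to all windows and to all entries of \<open>b\<close> but those at \<open>0\<close> and
  \<open>m\<close>. These two follow from the total and from the step from \<open>m - 1\<close> to \<open>m\<close>.
\<close>
lemma reduced_exponents_unique:
  assumes same: "same_image m a b a' b'"
    and red: "reduced_exponents m a b" "reduced_exponents m a' b'"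
    and m: "m > 0" and i: "i < 2 * m"
  shows "a i = a' i \<and> b i = b' i"
proof -
  have per: "\<forall>i. b (i + 2 * m) = b i" "\<forall>i. b' (i + 2 * m) = b' i"
    using same by (auto simp: same_image_def)
  have total: "(\<Sum>j=1..2*m. b j) = (\<Sum>j=1..2*m. b' j)"
    using same by (simp add: same_image_def)
  have w0: "window m b 0 = window m b' 0"
    using window_zero_not_less[OF same red m]
      window_zero_not_less[OF same_image_sym[OF same] red(2,1) m] by simp
  have w: "window m b l = window m b' l" if "l < m" for l
    using that by (induction l) (use w0 window_eq_step(1)[OF same red] in auto)
  have w': "window m b (m + l) = window m b' (m + l)" if "l < m" for l
    using window_opposite[OF per(1), of l] window_opposite[OF per(2), of l] w[OF that] total
    by simp
  have win: "window m b j = window m b' j" if "j < 2 * m" for j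
    using w[of j] w'[of "j - m"] that by (cases "j < m") auto
  have b: "b (Suc l) = b' (Suc l)" "b (m + Suc l) = b' (m + Suc l)" if "Suc l < m" for l
    using window_eq_step(2,3)[OF same red that] w that by auto
  have bm: "b m = b' m"
  proof -
    have "(\<Sum>k=1..m-1. b k) = (\<Sum>k=1..m-1. b' k)"
    proof (rule sum.cong)
      fix k assume "k \<in> {1..m-1}"
      then show "b k = b' k" using b(1)[of "k - 1"] by (cases k) auto
    qed simp
    then show ?thesis
      using window_zero_rise[OF per(1) m] window_zero_rise[OF per(2) m] w0 total by linarith
  qed
  have b0: "b 0 = b' 0"
  proof -
    have "window m b (Suc (m - 1)) + b (m + Suc (m - 1)) = window m b (m - 1) + b (Suc (m - 1))"
      "window m b' (Suc (m - 1)) + b' (m + Suc (m - 1)) = window m b' (m - 1) + b' (Suc (m - 1))"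
      using window_step[OF per(1)] window_step[OF per(2)] by blast+
    then show ?thesis
      using m per(1)[rule_format, of 0] per(2)[rule_format, of 0] bm w[of "m - 1"] w'[of 0] by (simp add: mult_2)
  qed
  have "b i = b' i"
  proof -
    consider "i = 0" | "0 < i" "i < m" | "i = m" | "m < i" by linarith
    then show ?thesis
    proof cases
      case 2
      then show ?thesis using b(1)[of "i - 1"] by simp
    next
      case 4
      then show ?thesis using b(2)[of "i - m - 1"] i by (simp add: Suc_diff_Suc)
    qed (use b0 bm in simp_all)
  qed
  moreover have "a i + window m b i = a' i + window m b' i"
    using same i by (simp add: same_image_def)
  ultimately show ?thesis using win[OF i] by simp
qed

section \<open>Binomials and fibres of monomial maps\<close>

abbreviation lookup where "lookup \<equiv> Poly_Mapping.lookup"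
abbreviation single where "single \<equiv> Poly_Mapping.single"
abbreviation keys where "keys \<equiv> Poly_Mapping.keys"

text \<open>
  The linear extension of a map \<open>\<psi>\<close> between monomials. It is a ring homomorphism if \<open>\<psi>\<close> is
  additive, that is, multiplicative on monomials.
\<close>
definition push_monom ::
  "('a \<Rightarrow> 'b) \<Rightarrow> ('a \<Rightarrow>\<^sub>0 'k::comm_ring_1) \<Rightarrow> ('b \<Rightarrow>\<^sub>0 'k)" where
  "push_monom \<psi> p = (\<Sum>u\<in>keys p. single (\<psi> u) (lookup p u))"

lemma push_monom_superset:
  assumes "finite A" "keys p \<subseteq> A"
  shows "push_monom \<psi> p = (\<Sum>u\<in>A. single (\<psi> u) (lookup p u))"
  unfolding push_monom_def
  by (rule sum.mono_neutral_left) (use assms in \<open>auto simp: in_keys_iff\<close>)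

lemma push_monom_zero [simp]: "push_monom \<psi> 0 = 0"
  by (simp add: push_monom_def)

lemma push_monom_single [simp]: "push_monom \<psi> (single u c) = single (\<psi> u) c"
  by (cases "c = 0") (simp_all add: push_monom_def)

lemma push_monom_add: "push_monom \<psi> (p + q) = push_monom \<psi> p + push_monom \<psi> q"
proof -
  let ?A = "keys p \<union> keys q"
  have "push_monom \<psi> (p + q) = (\<Sum>u\<in>?A. single (\<psi> u) (lookup (p + q) u))"
    by (rule push_monom_superset) (use Poly_Mapping.keys_add[of p q] in auto)
  also have "\<dots> = (\<Sum>u\<in>?A. single (\<psi> u) (lookup p u)) + (\<Sum>u\<in>?A. single (\<psi> u) (lookup q u))"
    by (simp add: lookup_add single_add sum.distrib)
  finally show ?thesis by (simp add: push_monom_superset[of ?A])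
qed

lemma push_monom_minus: "push_monom \<psi> (p - q) = push_monom \<psi> p - push_monom \<psi> q"
proof -
  have "push_monom \<psi> (p - q) + push_monom \<psi> q = push_monom \<psi> p"
    by (simp flip: push_monom_add)
  then show ?thesis by (simp add: eq_diff_eq)
qed

lemma push_monom_sum: "push_monom \<psi> (\<Sum>i\<in>I. p i) = (\<Sum>i\<in>I. push_monom \<psi> (p i))"
  by (induction I rule: infinite_finite_induct) (auto simp: push_monom_add)

lemma poly_mapping_eq_sum_single: "p = (\<Sum>u\<in>keys p. single u (lookup p u))"
  by (rule poly_mapping_eqI)
     (auto simp: lookup_sum lookup_single when_def in_keys_iff sum.delta' cong: if_cong)

lemma push_monom_mult:
  fixes \<psi> :: "'a::comm_monoid_add \<Rightarrow> 'b::comm_monoid_add"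
  assumes add: "\<And>u v. \<psi> (u + v) = \<psi> u + \<psi> v"
  shows "push_monom \<psi> (p * q) = push_monom \<psi> p * push_monom \<psi> q"
proof -
  have "p * q = (\<Sum>u\<in>keys p. \<Sum>v\<in>keys q. single (u + v) (lookup p u * lookup q v))"
    by (subst (1) poly_mapping_eq_sum_single[of p], subst (1) poly_mapping_eq_sum_single[of q])
       (simp add: sum_product mult_single)
  then show ?thesis
    by (simp add: push_monom_sum add push_monom_def[of _ p] push_monom_def[of _ q] 
        sum_product mult_single)
qed

lemma ideal_gen_subset_push_kernel:
  fixes \<psi> :: "'a::comm_monoid_add \<Rightarrow> 'b::comm_monoid_add"
    and S :: "('a \<Rightarrow>\<^sub>0 'k::comm_ring_1) set"
  assumes "\<And>u v. \<psi> (u + v) = \<psi> u + \<psi> v" and "\<And>p. p \<in> S \<Longrightarrow> push_monom \<psi> p = 0"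
  shows "ideal_gen S \<subseteq> {p. push_monom \<psi> p = 0}"
  by (rule module.span_minimal[OF module_times])
     (use assms in \<open>auto simp: module.subspace_def[OF module_times] push_monom_add push_monom_mult\<close>)

text \<open>
  In the image of \<open>p\<close> the term that comes from \<open>u\<close> can only be cancelled by terms of the same fibre.
\<close>
lemma push_kernel_companion:
  assumes "push_monom \<psi> p = 0" and u: "u \<in> keys p"
  obtains v where "v \<in> keys p" "v \<noteq> u" "\<psi> v = \<psi> u"
proof (rule ccontr)
  assume "\<not> thesis"
  with that have only: "\<psi> v \<noteq> \<psi> u" if "v \<in> keys p" "v \<noteq> u" for v using that by blast
  have "lookup (push_monom \<psi> p) (\<psi> u) = (\<Sum>v\<in>keys p. if v = u then lookup p v else 0)"
    unfolding push_monom_def lookup_sum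
    by (rule sum.cong) (use only in \<open>auto simp: lookup_single when_def\<close>)
  also have "\<dots> = lookup p u" using u by simp
  finally show False using assms by (simp add: in_keys_iff)
qed

lemma lead_monom_eqI:
  assumes "monomial_order lt" and "u \<in> keys p" and "\<And>v. v \<in> keys p \<Longrightarrow> v \<noteq> u \<Longrightarrow> lt v u"
  shows "lead_monom lt p = u"
  unfolding lead_monom_def
proof (rule the_equality)
  fix v assume v: "v \<in> keys p \<and> (\<forall>m'\<in>keys p. m' \<noteq> v \<longrightarrow> lt m' v)"
  show "v = u"
  proof (rule ccontr)
    assume "v \<noteq> u"
    then have "lt v u" "lt u v" using v assms(2,3) by auto
    with assms(1) show False unfolding monomial_order_def
      by (meson irreflpD transpD)
  qed
qed (use assms in auto)

lemma finite_has_greatest: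
  assumes "monomial_order lt" "finite A" "A \<noteq> {}"
  shows "\<exists>u\<in>A. \<forall>v\<in>A. v \<noteq> u \<longrightarrow> lt v u"
  using assms(2,3)
proof (induction A rule: finite_ne_induct)
  case (insert x A)
  then obtain u where u: "u \<in> A" "\<forall>v\<in>A. v \<noteq> u \<longrightarrow> lt v u" by blast
  have tr: "\<And>x y z. lt x y \<Longrightarrow> lt y z \<Longrightarrow> lt x z" and tot: "\<And>x y. x \<noteq> y \<Longrightarrow> lt x y \<or> lt y x"
    using assms(1) unfolding monomial_order_def transp_def totalp_on_def by blast+
  show ?case
  proof (cases "lt x u")
    case True
    then show ?thesis using u by blast
  next
    case False
    then have "lt u x" using tot[of x u] u insert by blast
    then have "\<forall>v\<in>insert x A. v \<noteq> x \<longrightarrow> lt v x"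
      using u(2) tr by (metis insertE)
    then show ?thesis by (rule bexI) simp
  qed
qed auto

lemma lead_monom_greatest:
  assumes "monomial_order lt" "p \<noteq> 0"
  shows "lead_monom lt p \<in> keys p"
    and "\<And>v. v \<in> keys p \<Longrightarrow> v \<noteq> lead_monom lt p \<Longrightarrow> lt v (lead_monom lt p)"
proof -
  obtain u where u: "u \<in> keys p" "\<And>v. v \<in> keys p \<Longrightarrow> v \<noteq> u \<Longrightarrow> lt v u"
    using finite_has_greatest[OF assms(1), of "keys p"] assms(2) by auto
  with lead_monom_eqI[OF assms(1) u] show "lead_monom lt p \<in> keys p"
    "\<And>v. v \<in> keys p \<Longrightarrow> v \<noteq> lead_monom lt p \<Longrightarrow> lt v (lead_monom lt p)" by auto
qed

lemma finite_has_least: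
  assumes "monomial_order lt" "finite A" "A \<noteq> {}"
  shows "\<exists>u\<in>A. \<forall>v\<in>A. \<not> lt v u"
  using assms(2,3)
proof (induction A rule: finite_ne_induct)
  case (singleton x)
  then show ?case using assms(1) by (auto simp: monomial_order_def irreflp_def)
next
  case (insert x A)
  then obtain u where u: "u \<in> A" "\<forall>v\<in>A. \<not> lt v u" by blast
  have tr: "\<And>x y z. lt x y \<Longrightarrow> lt y z \<Longrightarrow> lt x z" and irr: "\<And>x. \<not> lt x x"
    using assms(1) unfolding monomial_order_def transp_def irreflp_def by blast+
  show ?case
  proof (cases "lt x u")
    case True
    then have "\<forall>v\<in>insert x A. \<not> lt v x" using u tr irr by blast
    then show ?thesis by blast
  next
    case False
    then show ?thesis using u by blast
  qed
qed

lemma binomial_keys: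
  assumes "a \<noteq> b"
  shows "keys (monom_poly a - monom_poly b :: ('v, 'k::comm_ring_1) mpoly) = {a, b}"
  using assms by (auto simp: in_keys_iff lookup_minus monom_poly_def lookup_single when_def split: if_splits)

lemma lead_monom_binomial:
  assumes lt: "monomial_order lt" "lt b a"
  shows "(monom_poly a - monom_poly b :: ('v, 'k::comm_ring_1) mpoly) \<noteq> 0"
    and "lead_monom lt (monom_poly a - monom_poly b :: ('v, 'k::comm_ring_1) mpoly) = a"
proof -
  have "a \<noteq> b" using lt by (auto simp: monomial_order_def irreflp_def)
  from binomial_keys[OF this, where ?'k='k]
  show "(monom_poly a - monom_poly b :: ('v, 'k::comm_ring_1) mpoly) \<noteq> 0"
    and "lead_monom lt (monom_poly a - monom_poly b :: ('v, 'k::comm_ring_1) mpoly) = a"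
    using lt by (auto intro!: lead_monom_eqI)
qed

definition standard_monom ::
  "(('v \<Rightarrow>\<^sub>0 nat) \<Rightarrow> ('v \<Rightarrow>\<^sub>0 nat) \<Rightarrow> bool) \<Rightarrow> ('v, 'k::comm_ring_1) mpoly set
    \<Rightarrow> ('v \<Rightarrow>\<^sub>0 nat) \<Rightarrow> bool" where
  "standard_monom lt G u \<longleftrightarrow> (\<forall>g\<in>G. \<exists>v. lookup u v < lookup (lead_monom lt g) v)"

lemma monom_divides:
  fixes a u :: "'v \<Rightarrow>\<^sub>0 nat"
  assumes "\<And>v. lookup a v \<le> lookup u v"
  shows "u = (u - a) + a"
  by (rule poly_mapping_eqI) (use assms in \<open>simp add: lookup_add lookup_minus\<close>)

text \<open>
  Reduction by \<open>G\<close> does not leave a fibre of \<open>\<psi>\<close>, so the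
  least element of each fibre is standard. Finiteness of the fibres provides this least element and
  takes the place of the well-foundedness of \<open>lt\<close>.
\<close>
lemma groebner_basis_by_fibres:
  fixes lt :: "('v \<Rightarrow>\<^sub>0 nat) \<Rightarrow> ('v \<Rightarrow>\<^sub>0 nat) \<Rightarrow> bool"
    and \<psi> :: "('v \<Rightarrow>\<^sub>0 nat) \<Rightarrow> 'b::comm_monoid_add"
    and G I :: "('v, 'k::comm_ring_1) mpoly set"
  assumes lt: "monomial_order lt"
    and add: "\<And>u v. \<psi> (u + v) = \<psi> u + \<psi> v"
    and fin: "\<And>u. finite {v. \<psi> v = \<psi> u}"
    and "finite G" and "G \<subseteq> I" and I: "\<And>p. p \<in> I \<Longrightarrow> push_monom \<psi> p = 0"
    and bin: "\<And>g. g \<in> G \<Longrightarrow> \<exists>a b. g = monom_poly a - monom_poly b \<and> lt b a"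
    and unique: "\<And>u v. \<psi> u = \<psi> v \<Longrightarrow> standard_monom lt G u \<Longrightarrow> standard_monom lt G v \<Longrightarrow> u = v"
  shows "is_groebner_basis lt G I"
proof -
  have G0: "0 \<notin> G"
  proof
    assume "0 \<in> G"
    then obtain a b where "(0 :: ('v, 'k) mpoly) = monom_poly a - monom_poly b" "lt b a"
      using bin by blast
    then show False using lead_monom_binomial(1)[OF lt, of b a, where ?'k='k] by simp
  qed
  have reduce: "\<exists>w. \<psi> w = \<psi> u \<and> lt w u" if nonstd: "\<not> standard_monom lt G u" for u
  proof -
    obtain g where g: "g \<in> G" and div: "\<And>v. lookup (lead_monom lt g) v \<le> lookup u v"
      using nonstd by (auto simp: standard_monom_def not_less)
    obtain a b where ab: "g = monom_poly a - monom_poly b" "lt b a" using bin[OF g] by blast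
    have lead: "lead_monom lt g = a" using lead_monom_binomial(2)[OF lt ab(2)] ab(1) by simp
    have "single (\<psi> a) (1::'k) = single (\<psi> b) 1"
      using I[of g] g \<open>G \<subseteq> I\<close> ab(1) by (auto simp: push_monom_minus monom_poly_def)
    then have "\<psi> a = \<psi> b"
      by (metis keys_single one_neq_zero singleton_inject)
    moreover have u: "u = (u - a) + a" using monom_divides div lead by blast
    ultimately have "\<psi> ((u - a) + b) = \<psi> u" using add by metis
    moreover have "lt (b + (u - a)) (a + (u - a))"
      using lt ab(2) unfolding monomial_order_def by blast
    ultimately show ?thesis using u by (metis add.commute)
  qed
  \<comment> \<open>The least element among the monomials of the fibre that do not exceed \<open>v\<close> is standard, hence it
    is \<open>u\<close>.\<close>
  have least: "u = v \<or> lt u v" if std: "standard_monom lt G u" and v: "\<psi> v = \<psi> u" for u v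
  proof -
    let ?A = "{w. \<psi> w = \<psi> u \<and> (w = v \<or> lt w v)}"
    have "finite ?A"
      using fin[of u] by (rule rev_finite_subset) blast
    moreover have "?A \<noteq> {}" using v by blast
    ultimately obtain w where "w \<in> ?A" and least: "\<forall>w'\<in>?A. \<not> lt w' w"
      using finite_has_least[OF lt] by meson
    then have w: "\<psi> w = \<psi> u" "w = v \<or> lt w v" by auto
    have min: "\<not> lt w' w" if "\<psi> w' = \<psi> u" "w' = v \<or> lt w' v" for w'
      using least that by blast
    have "standard_monom lt G w"
    proof (rule ccontr)
      assume "\<not> standard_monom lt G w"
      then obtain w' where w': "\<psi> w' = \<psi> w" "lt w' w" using reduce by blast
      then have "lt w' v" using w(2) lt unfolding monomial_order_def by (meson transpD)
      then show False using min[of w'] w' w(1) by simp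
    qed
    then have "u = w" using unique std w(1) by simp
    then show ?thesis using w(2) by simp
  qed
  have lead_div: "\<not> standard_monom lt G (lead_monom lt p)" if p: "p \<in> I" "p \<noteq> 0" for p
  proof
    assume std: "standard_monom lt G (lead_monom lt p)"
    obtain v where v: "v \<in> keys p" "v \<noteq> lead_monom lt p" "\<psi> v = \<psi> (lead_monom lt p)"
      using push_kernel_companion[OF I[OF p(1)] lead_monom_greatest(1)[OF lt p(2)]] by blast
    have "lt v (lead_monom lt p)" using lead_monom_greatest(2)[OF lt p(2)] v by blast
    moreover have "lt (lead_monom lt p) v" using least[OF std v(3)] v(2) by auto
    ultimately show False using lt unfolding monomial_order_def by (meson irreflpD transpD)
  qed
  let ?inG = "{monom_poly (lead_monom lt g) | g. g \<in> G} :: ('v, 'k) mpoly set"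
  have "initial_ideal lt I \<subseteq> ideal_gen ?inG"
    unfolding initial_ideal_def
  proof (rule module.span_minimal[OF module_times _ module.subspace_span[OF module_times]],
      rule subsetI)
    fix q :: "('v, 'k) mpoly"
    assume "q \<in> {monom_poly (lead_monom lt p) | p. p \<in> I \<and> p \<noteq> 0}"
    then obtain p where p: "p \<in> I" "p \<noteq> 0" "q = monom_poly (lead_monom lt p)" by blast
    obtain g where g: "g \<in> G" "\<And>v. lookup (lead_monom lt g) v \<le> lookup (lead_monom lt p) v"
      using lead_div[OF p(1,2)] by (auto simp: standard_monom_def not_less)
    have "q = monom_poly (lead_monom lt p - lead_monom lt g) * monom_poly (lead_monom lt g)"
      using monom_divides[OF g(2)] p(3) by (simp add: monom_poly_def mult_single)
    moreover have "monom_poly (lead_monom lt g) \<in> ideal_gen ?inG"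
      by (rule module.span_base[OF module_times]) (use g(1) in blast)
    ultimately show "q \<in> ideal_gen ?inG"
      using module.span_scale[OF module_times] by simp
  qed
  moreover have "?inG \<subseteq> {monom_poly (lead_monom lt p) | p. p \<in> I \<and> p \<noteq> 0}"
  proof
    fix q assume "q \<in> ?inG"
    then obtain g where "g \<in> G" "q = monom_poly (lead_monom lt g)" by blast
    moreover have "g \<noteq> 0" using \<open>g \<in> G\<close> G0 by metis
    ultimately show "q \<in> {monom_poly (lead_monom lt p) | p. p \<in> I \<and> p \<noteq> 0}"
      using \<open>G \<subseteq> I\<close> by blast
  qed
  then have "ideal_gen ?inG \<subseteq> initial_ideal lt I"
    unfolding initial_ideal_def by (rule module.span_mono[OF module_times])
  ultimately have "initial_ideal lt I = ideal_gen ?inG" by (rule equalityI)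
  with \<open>finite G\<close> G0 \<open>G \<subseteq> I\<close> show ?thesis
    unfolding is_groebner_basis_def by (intro conjI)
qed

section \<open>The monomial orders\<close>

lemma monom_degree_add: "monom_degree (a + b) = monom_degree a + monom_degree b"
  by (simp add: monom_degree_def lookup_add sum.distrib)

lemma of_nat_mod_ring_eq_iff:
  "(of_nat i :: 'n::nontriv mod_ring) = of_nat j \<longleftrightarrow> i mod CARD('n) = j mod CARD('n)"
proof -
  have "(of_nat i :: 'n mod_ring) = of_nat j \<longleftrightarrow> int i mod int CARD('n) = int j mod int CARD('n)"
    unfolding of_nat_of_int_mod_ring o_def by transfer simp
  then show ?thesis by (simp flip: zmod_int)
qed

lemma of_nat_mod_ring_inj:
  assumes "i \<in> {1..CARD('n)}" "j \<in> {1..CARD('n)}" "(of_nat i :: 'n::nontriv mod_ring) = of_nat j"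
  shows "i = j"
  using assms nontriv[where ?'a='n] unfolding of_nat_mod_ring_eq_iff
  by (cases "i = CARD('n)"; cases "j = CARD('n)") (auto simp: le_less)

lemma mod_ring_index_cases:
  fixes i :: "'n::nontriv mod_ring"
  obtains k where "k \<in> {1..CARD('n)}" "i = of_nat k"
proof -
  let ?f = "of_nat :: nat \<Rightarrow> 'n mod_ring"
  have "inj_on ?f {1..CARD('n)}" by (rule inj_onI) (rule of_nat_mod_ring_inj)
  then have "card (?f ` {1..CARD('n)}) = CARD('n mod_ring)" by (simp add: card_image)
  then have "?f ` {1..CARD('n)} = UNIV" by (intro card_subset_eq) auto
  then show thesis using that by (metis UNIV_I imageE)
qed

lemma monomial_order_revlex:
  "monomial_order (revlex :: ('n::nontriv mod_ring \<Rightarrow>\<^sub>0 nat) \<Rightarrow> _)"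
  unfolding monomial_order_def
proof (intro conjI allI impI)
  let ?lt = "revlex :: ('n mod_ring \<Rightarrow>\<^sub>0 nat) \<Rightarrow> _"
  let ?at = "\<lambda>(a :: 'n mod_ring \<Rightarrow>\<^sub>0 nat) j. lookup a (of_nat j)"
  show "irreflp ?lt" by (auto simp: irreflp_def revlex_def)
  show "transp ?lt"
  proof (rule transpI)
    fix a b c :: "'n mod_ring \<Rightarrow>\<^sub>0 nat"
    assume ab: "?lt a b" and bc: "?lt b c"
    show "?lt a c"
    proof (cases "monom_degree a = monom_degree b \<and> monom_degree b = monom_degree c")
      case False
      then show ?thesis using ab bc by (auto simp: revlex_def)
    next
      case True
      \<comment> \<open>The last position where \<open>a\<close> and \<open>c\<close> differ is the later of the two given ones.\<close>
      obtain j where j: "j \<in> {1..CARD('n)}" "?at a j > ?at b j"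
          "\<forall>i\<in>{j<..CARD('n)}. ?at a i = ?at b i"
        using ab True unfolding revlex_def by auto
      obtain k where k: "k \<in> {1..CARD('n)}" "?at b k > ?at c k"
          "\<forall>i\<in>{k<..CARD('n)}. ?at b i = ?at c i"
        using bc True unfolding revlex_def by auto
      have "?at a (max j k) > ?at c (max j k)"
        using j k by (cases j k rule: linorder_cases) (auto simp: max_def)
      moreover have "\<forall>i\<in>{max j k<..CARD('n)}. ?at a i = ?at c i"
        using j(3) k(3) by auto
      moreover have "max j k \<in> {1..CARD('n)}" using j(1) k(1) by auto
      ultimately show ?thesis using True unfolding revlex_def by auto
    qed
  qed
  show "totalp ?lt"
  proof (rule totalpI)
    fix a b :: "'n mod_ring \<Rightarrow>\<^sub>0 nat"
    assume ne: "a \<noteq> b"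
    show "?lt a b \<or> ?lt b a"
    proof (cases "monom_degree a = monom_degree b")
      case False
      then show ?thesis by (auto simp: revlex_def)
    next
      case True
      let ?D = "{j \<in> {1..CARD('n)}. ?at a j \<noteq> ?at b j}"
      have "?D \<noteq> {}"
      proof
        assume D: "?D = {}"
        have "lookup a i = lookup b i" for i
          by (rule mod_ring_index_cases[of i]) (use D in auto)
        then show False using ne by (simp add: poly_mapping_eqI)
      qed
      then have max: "Max ?D \<in> ?D" by (intro Max_in) auto
      have above: "?at a i = ?at b i" if "i \<in> {Max ?D<..CARD('n)}" for i
      proof (rule ccontr)
        assume "?at a i \<noteq> ?at b i"
        then have "i \<in> ?D" using that max by auto
        then have "i \<le> Max ?D" by (intro Max_ge) auto
        then show False using that by simp
      qed
      define k where "k = Max ?D"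
      have k: "k \<in> {1..CARD('n)}" "?at a k \<noteq> ?at b k"
        and k': "\<forall>i\<in>{k<..CARD('n)}. ?at a i = ?at b i"
        using max above unfolding k_def by blast+
      have "revlex a b" if "?at a k > ?at b k"
        unfolding revlex_def using True k(1) k' that by (intro disjI2 conjI bexI[of _ k]) auto
      moreover have "revlex b a" if "?at b k > ?at a k"
        unfolding revlex_def using True k(1) k' that by (intro disjI2 conjI bexI[of _ k]) auto
      ultimately show ?thesis using k(2) by (metis linorder_neqE_nat)
    qed
  qed
next
  fix a :: "'n mod_ring \<Rightarrow>\<^sub>0 nat"
  assume "a \<noteq> 0"
  then obtain i where "lookup a i \<noteq> 0" by (metis poly_mapping_eqI lookup_zero)
  then have "0 < monom_degree a" by (auto simp: monom_degree_def intro: sum_pos2[of _ i])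
  then show "revlex 0 a" by (simp add: revlex_def monom_degree_def)
next
  fix a b c :: "'n mod_ring \<Rightarrow>\<^sub>0 nat"
  assume "revlex a b"
  then show "revlex (a + c) (b + c)" by (auto simp: revlex_def monom_degree_add lookup_add)
qed

lemma inj_xy_var: "inj X" "inj Y"
  by (auto simp: inj_def)

lemma lookup_map_key_XY:
  "lookup (Poly_Mapping.map_key X u) i = lookup u (X i)"
  "lookup (Poly_Mapping.map_key Y u) i = lookup u (Y i)"
  by (simp_all add: map_key.rep_eq inj_xy_var)

text \<open>
  A monomial of \<open>T\<close> is determined by its two parts, which makes the product order total.
\<close>
lemma monomial_order_product:
  assumes "monomial_order lt1" "monomial_order lt2"
  shows "monomial_order (product_order lt1 lt2)"
proof -
  let ?X = "Poly_Mapping.map_key X" and ?Y = "Poly_Mapping.map_key Y"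
  have determined: "u = v" if "?X u = ?X v" "?Y u = ?Y v" for u v :: "'a xy_var \<Rightarrow>\<^sub>0 nat"
  proof (rule poly_mapping_eqI)
    fix w show "lookup u w = lookup v w"
      using that by (cases w) (metis lookup_map_key_XY)+
  qed
  have irr: "\<not> lt1 u u" "\<not> lt2 u u" for u
    using assms by (auto simp: monomial_order_def irreflp_def)
  have tr: "lt1 u w" if "lt1 u v" "lt1 v w" for u v w
    using assms(1) that by (auto simp: monomial_order_def dest: transpD)
  have tr': "lt2 u w" if "lt2 u v" "lt2 v w" for u v w
    using assms(2) that by (auto simp: monomial_order_def dest: transpD)
  have tot: "lt1 u v \<or> lt1 v u" "lt2 u v \<or> lt2 v u" if "u \<noteq> v" for u v
    using assms that by (auto simp: monomial_order_def totalp_on_def)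
  have pos: "lt1 0 u" "lt2 0 u" if "u \<noteq> 0" for u
    using assms that by (auto simp: monomial_order_def)
  have shift: "lt1 u v \<Longrightarrow> lt1 (u + w) (v + w)" "lt2 u v \<Longrightarrow> lt2 (u + w) (v + w)" for u v w
    using assms by (auto simp: monomial_order_def)
  show ?thesis
    unfolding monomial_order_def
  proof (intro conjI allI impI)
    show "irreflp (product_order lt1 lt2)"
      using irr by (simp add: irreflp_def product_order_def)
    show "transp (product_order lt1 lt2)"
      unfolding product_order_def by (rule transpI) (auto dest: tr tr')
    show "totalp (product_order lt1 lt2)"
    proof (rule totalpI)
      fix u v :: "'a xy_var \<Rightarrow>\<^sub>0 nat"
      assume "u \<noteq> v"
      then consider "?Y u \<noteq> ?Y v" | "?Y u = ?Y v" "?X u \<noteq> ?X v" using determined by blast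
      then show "product_order lt1 lt2 u v \<or> product_order lt1 lt2 v u"
        by cases (use tot in \<open>auto simp: product_order_def\<close>)
    qed
  next
    fix u :: "'a xy_var \<Rightarrow>\<^sub>0 nat"
    assume "u \<noteq> 0"
    then have "?Y u \<noteq> 0 \<or> ?X u \<noteq> 0"
      using determined[of u 0] by (auto simp: map_key_zero inj_xy_var)
    then show "product_order lt1 lt2 0 u"
      using pos by (auto simp: product_order_def map_key_zero inj_xy_var)
  next
    fix u v w :: "'a xy_var \<Rightarrow>\<^sub>0 nat"
    assume "product_order lt1 lt2 u v"
    then show "product_order lt1 lt2 (u + w) (v + w)"
      using shift by (auto simp: product_order_def map_key_plus inj_xy_var)
  qed
qed

section \<open>Elements of $L$ and $HT$\<close>

lemma monom_poly_mult: "monom_poly a * monom_poly b = monom_poly (a + b)"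
  by (simp add: monom_poly_def mult_single)

lemma monom_poly_zero: "monom_poly 0 = 1"
  by (simp add: monom_poly_def)

lemma prod_monom_poly: "(\<Prod>i\<in>I. monom_poly (e i)) = monom_poly (\<Sum>i\<in>I. e i)"
  by (induction I rule: infinite_finite_induct) (auto simp: monom_poly_mult monom_poly_zero)

lemma x_var_monom: "x_var i = monom_poly (single (X (of_nat i)) 1)"
  by (simp add: x_var_def Var_def)

lemma y_var_monom: "y_var i = monom_poly (single (Y (of_nat i)) 1)"
  by (simp add: y_var_def Var_def)

lemma x_var_periodic: "(x_var (i + CARD('n)) :: ('n::nontriv, 'k::field) T) = x_var i"
  by (simp add: x_var_def)

lemma y_var_periodic: "(y_var (i + CARD('n)) :: ('n::nontriv, 'k::field) T) = y_var i"
  by (simp add: y_var_def)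

definition x_interval :: "nat \<Rightarrow> nat \<Rightarrow> ('n::nontriv, 'k::field) T" where
  "x_interval i j = (\<Prod>k=i..<j. x_var k)"

lemma x_interval_concat: "i \<le> j \<Longrightarrow> j \<le> k \<Longrightarrow> x_interval i j * x_interval j k = x_interval i k"
  by (simp add: x_interval_def prod.atLeastLessThan_concat)

lemma x_interval_single: "x_interval i (Suc i) = x_var i"
  by (simp add: x_interval_def)

lemma x_interval_periodic:
  "(x_interval (i + CARD('n)) (j + CARD('n)) :: ('n::nontriv, 'k::field) T) = x_interval i j"
  unfolding x_interval_def by (subst prod.shift_bounds_nat_ivl) (simp add: x_var_periodic)

text \<open>
  An interval of length \<open>n\<close> is cut at \<open>n\<close>, and its second piece is moved back by one period. Working
  with a product of two pieces avoids cancellation in \<open>T\<close>.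
\<close>
lemma x_interval_full_cycle:
  assumes "i \<le> CARD('n)"
  shows "(x_interval i (i + CARD('n)) :: ('n::nontriv, 'k::field) T) = x_interval 0 CARD('n)"
proof -
  have "(x_interval i (i + CARD('n)) :: ('n, 'k) T)
      = x_interval i CARD('n) * x_interval CARD('n) (i + CARD('n))"
    using assms by (simp add: x_interval_concat)
  also have "\<dots> = x_interval 0 i * x_interval i CARD('n)"
    using x_interval_periodic[of 0 i, where ?'n='n and ?'k='k] by (simp add: mult.commute)
  finally show ?thesis using assms by (simp add: x_interval_concat)
qed

lemma x_interval_monom: "x_interval i j = monom_poly (\<Sum>k=i..<j. single (X (of_nat k)) 1)"
  by (simp add: x_interval_def x_var_monom prod_monom_poly)

lemma path_gen_eq:
  assumes "CARD('n) \<ge> 2"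
  shows "(path_gen j :: ('n::nontriv, 'k::field) T) = x_interval j (j + CARD('n) div 2)"
proof -
  have "{j..j + CARD('n) div 2 - 1} = {j..<j + CARD('n) div 2}"
    using assms by auto
  then show ?thesis by (simp add: path_gen_def x_interval_def)
qed

lemma f_poly_binomial:
  "(f_poly j :: ('n::nontriv, 'k::field) T) =
     monom_poly (single (X (of_nat (CARD('n) div 2 + j))) 1 + single (Y (of_nat j)) 1) -
     monom_poly (single (X (of_nat j)) 1 + single (Y (of_nat (j + 1))) 1)"
  by (simp only: f_poly_def x_var_monom y_var_monom monom_poly_mult)

lemma g_poly_eq:
  assumes "k \<ge> 1"
  shows "(g_poly k :: ('n::nontriv, 'k::field) T) =
    x_interval 0 k * y_var k - x_interval (CARD('n) div 2) (k + CARD('n) div 2) * y_var 0"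
proof -
  have "{0..k - 1} = {0..<k}"
    "{CARD('n) div 2..k - 1 + CARD('n) div 2} = {CARD('n) div 2..<k + CARD('n) div 2}"
    using assms by auto
  then show ?thesis by (simp add: g_poly_def x_interval_def mult.commute)
qed

lemma g_poly_binomial:
  assumes "k \<ge> 1"
  shows "(g_poly k :: ('n::nontriv, 'k::field) T) =
     monom_poly ((\<Sum>i=0..<k. single (X (of_nat i)) 1) + single (Y (of_nat k)) 1) -
     monom_poly ((\<Sum>i=CARD('n) div 2..<k + CARD('n) div 2. single (X (of_nat i)) 1)
       + single (Y (of_nat 0)) 1)"
  by (simp only: g_poly_eq[OF assms] x_interval_monom y_var_monom monom_poly_mult)

lemma h_poly_binomial:
  "(h_poly l :: ('n::nontriv, 'k::field) T) =
     monom_poly (single (Y (of_nat l)) 1 + single (Y (of_nat (l + CARD('n) div 2))) 1) -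
     monom_poly (single (Y (of_nat 0)) 1 + single (Y (of_nat (CARD('n) div 2))) 1)"
  by (simp only: h_poly_def y_var_monom monom_poly_mult)

lemma x_interval_in_poly_ring: "x_interval i j \<in> poly_ring (range X)"
proof -
  have "keys (\<Sum>k=i..<j. single (X (of_nat k) :: 'n::nontriv mod_ring xy_var) (1::nat)) \<subseteq> range X"
    using keys_sum[of "\<lambda>k. single (X (of_nat k) :: 'n mod_ring xy_var) (1::nat)" "{i..<j}"] by auto
  then show ?thesis by (auto simp: x_interval_monom poly_ring_def monom_poly_def)
qed

text \<open>
  All \<open>f\<^sub>j\<close> and \<open>g\<^sub>k\<close> have this form: they come from a common multiple of two path monomials.
\<close>
lemma L_ideal_two_term:
  fixes a b :: "('n::nontriv, 'k::field) T"
  assumes jk: "j \<in> {1..CARD('n)}" "k \<in> {1..CARD('n)}" "j \<noteq> k"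
    and ab: "a \<in> poly_ring (range X)" "b \<in> poly_ring (range X)"
    and rel: "a * path_gen j = b * path_gen k"
  shows "a * y_var j - b * y_var k \<in> L_ideal"
proof -
  define c where "c i = (if i = j then a else if i = k then - b else 0)" for i
  have sum: "(\<Sum>i=1..CARD('n). c i * z i) = a * z j - b * z k" for z
  proof -
    have "(\<Sum>i=1..CARD('n). c i * z i)
        = (\<Sum>i=1..CARD('n). (if i = j then a * z i else 0) + (if i = k then - b * z i else 0))"
      by (rule sum.cong) (use jk(3) in \<open>auto simp: c_def\<close>)
    then show ?thesis using jk(1,2) by (simp add: sum.distrib)
  qed
  have "\<forall>i\<in>{1..CARD('n)}. c i \<in> poly_ring (range X)"
    using ab by (auto simp: c_def poly_ring_def)
  moreover have "(\<Sum>i=1..CARD('n). c i * path_gen i) = 0"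
    using rel unfolding sum by simp
  ultimately have "(\<Sum>i=1..CARD('n). c i * y_var i) \<in> L_ideal"
    unfolding L_ideal_def sym_ideal_def
    by (intro module.span_base[OF module_times]) blast
  then show ?thesis unfolding sum .
qed

text \<open>
  The path starting at \<open>j\<close>, prolonged by the vertex after its end, is the path starting at \<open>j + 1\<close>
  with the vertex \<open>j\<close> put in front.
\<close>
lemma f_poly_in_L:
  assumes "j \<in> {1..CARD('n) - 1}" "CARD('n) \<ge> 2"
  shows "(f_poly j :: ('n::nontriv, 'k::field) T) \<in> L_ideal"
proof -
  let ?m = "CARD('n) div 2"
  let ?x = "x_interval :: nat \<Rightarrow> nat \<Rightarrow> ('n, 'k) T"
  have "?x j (j + ?m) * ?x (j + ?m) (Suc (j + ?m)) = ?x j (Suc j) * ?x (Suc j) (Suc (j + ?m))"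
    using assms by (simp add: x_interval_concat)
  then have "?x (?m + j) (Suc (?m + j)) * path_gen j = ?x j (Suc j) * path_gen (j + 1)"
    using assms by (simp add: path_gen_eq algebra_simps)
  then have "?x (?m + j) (Suc (?m + j)) * y_var j - ?x j (Suc j) * y_var (j + 1) \<in> L_ideal"
    using assms(1) by (intro L_ideal_two_term x_interval_in_poly_ring) auto
  then show ?thesis by (simp add: f_poly_def x_interval_single)
qed

text \<open>
  The interval from \<open>0\<close> to \<open>k + m - 1\<close> is a path starting at \<open>k\<close> with \<open>k\<close> vertices in front, and a
  path starting at \<open>0\<close> with \<open>k\<close> vertices behind. In the sum that defines \<open>L\<close> the variable \<open>y\<^sub>0\<close> has
  the index \<open>n\<close>.
\<close>
lemma g_poly_in_L:
  assumes "k \<in> {1..CARD('n) div 2 - 1}"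
  shows "(g_poly k :: ('n::nontriv, 'k::field) T) \<in> L_ideal"
proof -
  let ?m = "CARD('n) div 2"
  let ?x = "x_interval :: nat \<Rightarrow> nat \<Rightarrow> ('n, 'k) T"
  have n: "CARD('n) \<ge> 2" "k < CARD('n)" using assms by auto
  have "?x 0 k * ?x k (k + ?m) = ?x 0 ?m * ?x ?m (k + ?m)"
    by (simp add: x_interval_concat)
  moreover have "(path_gen CARD('n) :: ('n, 'k) T) = ?x 0 ?m"
    using x_interval_periodic[of 0 ?m, where ?'n='n and ?'k='k] n
    by (simp add: path_gen_eq add.commute)
  ultimately have "?x 0 k * path_gen k = ?x ?m (k + ?m) * path_gen CARD('n)"
    using n by (simp add: path_gen_eq mult.commute)
  then have "?x 0 k * y_var k - ?x ?m (k + ?m) * y_var CARD('n) \<in> L_ideal"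
    using assms n by (intro L_ideal_two_term x_interval_in_poly_ring) auto
  moreover have "(y_var CARD('n) :: ('n, 'k) T) = y_var 0"
    using y_var_periodic[of 0, where ?'n='n and ?'k='k] by simp
  ultimately show ?thesis using assms by (simp add: g_poly_eq)
qed

lemma h_poly_in_HT:
  assumes "l \<in> {1..CARD('n) div 2 - 1}"
  shows "(h_poly l :: ('n::nontriv, 'k::field) T) \<in> HT_ideal"
proof -
  let ?c = "\<lambda>i. if i = l then 1 else (0 :: ('n, 'k) T)"
  have "(\<Sum>i=1..CARD('n) div 2 - 1. ?c i * h_poly i)
      = (\<Sum>i=1..CARD('n) div 2 - 1. if i = l then h_poly i else 0)"
    by (rule sum.cong) auto
  also have "\<dots> = h_poly l" using assms by simp
  finally have "h_poly l \<in> (H_ideal :: ('n, 'k) T set)"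
    unfolding H_ideal_def poly_ring_def
    by (intro CollectI exI[of _ ?c]) (auto simp: in_keys_iff)
  then show ?thesis
    unfolding HT_ideal_def by (rule module.span_base[OF module_times])
qed

section \<open>The Rees map\<close>

text \<open>
  The Rees map \<open>x\<^sub>i \<mapsto> x\<^sub>i\<close>, \<open>y\<^sub>j \<mapsto> u\<^sub>j t\<close> on monomials. The variable \<open>y\<^sub>0\<close> of \<open>T\<close> serves as \<open>t\<close>,
  which makes it an endomorphism of the monoid of monomials. The paths through \<open>i\<close> are those that
  start at one of \<open>i, i - 1, \<dots>, i - m + 1\<close>.
\<close>
definition rees_exponent ::
  "('n::nontriv mod_ring xy_var \<Rightarrow>\<^sub>0 nat) \<Rightarrow> ('n mod_ring xy_var \<Rightarrow>\<^sub>0 nat)" where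
  "rees_exponent u = Poly_Mapping.Abs_poly_mapping (\<lambda>v. case v of
       X i \<Rightarrow> lookup u (X i) + (\<Sum>r<CARD('n) div 2. lookup u (Y (i - of_nat r)))
     | Y j \<Rightarrow> if j = 0 then \<Sum>i\<in>UNIV. lookup u (Y i) else 0)"

lemma finite_xy_var: "finite (A :: 'i::finite xy_var set)"
proof (rule finite_subset)
  show "A \<subseteq> range X \<union> range Y"
  proof
    fix v :: "'i xy_var" show "v \<in> range X \<union> range Y" by (cases v) auto
  qed
qed simp

lemma lookup_rees_exponent:
  fixes u :: "'n::nontriv mod_ring xy_var \<Rightarrow>\<^sub>0 nat"
  shows "lookup (rees_exponent u) (X i)
      = lookup u (X i) + (\<Sum>r<CARD('n) div 2. lookup u (Y (i - of_nat r)))"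
    and "lookup (rees_exponent u) (Y j) = (if j = 0 then \<Sum>i\<in>UNIV. lookup u (Y i) else 0)"
  by (simp_all add: rees_exponent_def lookup_Abs_poly_mapping finite_xy_var)

lemma rees_exponent_add: "rees_exponent (u + v) = rees_exponent u + rees_exponent v"
proof (rule poly_mapping_eqI)
  fix w show "lookup (rees_exponent (u + v)) w = lookup (rees_exponent u + rees_exponent v) w"
    by (cases w) (simp_all add: lookup_add lookup_rees_exponent sum.distrib)
qed

text \<open>
  Each exponent of \<open>x\<^sub>i\<close> is bounded by that of the image, and each exponent of \<open>y\<^sub>j\<close> by the
  exponent of \<open>t\<close> in the image.
\<close>
lemma finite_rees_fibre: "finite {v. rees_exponent v = rees_exponent u}"
proof -
  define bound where
    "bound w = (case w of X i \<Rightarrow> lookup (rees_exponent u) (X i) | Y j \<Rightarrow> lookup (rees_exponent u) (Y 0))"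
    for w
  have "lookup v w \<le> bound w" if "rees_exponent v = rees_exponent u" for v w
  proof (cases w)
    case (X i)
    then show ?thesis using that[symmetric] by (simp add: bound_def lookup_rees_exponent)
  next
    case (Y j)
    then show ?thesis using that[symmetric]
      by (auto simp: bound_def lookup_rees_exponent intro: member_le_sum)
  qed
  then have "lookup ` {v. rees_exponent v = rees_exponent u} \<subseteq> PiE UNIV (\<lambda>w. {..bound w})"
    by auto
  moreover have "finite (PiE UNIV (\<lambda>w. {..bound w}))"
    by (rule finite_PiE) (auto intro: finite_xy_var)
  ultimately have "finite (lookup ` {v. rees_exponent v = rees_exponent u})"
    by (rule finite_subset)
  then show ?thesis by (rule finite_imageD) (auto intro!: inj_onI poly_mapping_eqI)
qed

lemma rees_exponent_X_part:
  assumes "keys u \<subseteq> range X"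
  shows "rees_exponent u = u"
proof (rule poly_mapping_eqI)
  have Y: "lookup u (Y j) = 0" for j
    using assms by (force simp: in_keys_iff)
  fix w show "lookup (rees_exponent u) w = lookup u w"
    by (cases w) (simp_all add: lookup_rees_exponent Y)
qed

lemma push_rees_X_part:
  assumes "p \<in> poly_ring (range X)"
  shows "push_monom rees_exponent p = p"
proof -
  have "push_monom rees_exponent p = (\<Sum>u\<in>keys p. single u (lookup p u))"
    unfolding push_monom_def
    by (rule sum.cong) (use assms in \<open>auto simp: poly_ring_def rees_exponent_X_part\<close>)
  then show ?thesis using poly_mapping_eq_sum_single[of p] by simp
qed

lemma rees_exponent_Y:
  "rees_exponent (single (Y (of_nat j)) 1 :: 'n::nontriv mod_ring xy_var \<Rightarrow>\<^sub>0 nat) =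
     (\<Sum>i=j..<j + CARD('n) div 2. single (X (of_nat i)) 1) + single (Y 0) 1"
  (is "?l = ?r")
proof (rule poly_mapping_eqI)
  fix w show "lookup ?l w = lookup ?r w"
  proof (cases w)
    case (X i)
    have "(\<Sum>r<CARD('n) div 2. (1::nat) when of_nat j = i - of_nat r)
        = (\<Sum>k=j..<j + CARD('n) div 2. 1 when of_nat k = i)"
      by (rule sum.reindex_bij_witness[of _ "\<lambda>k. k - j" "\<lambda>r. j + r"])
         (auto simp: algebra_simps intro!: when_cong)
    then show ?thesis
      using X by (simp add: lookup_rees_exponent lookup_add lookup_sum lookup_single)
  next
    case (Y i)
    then show ?thesis
      by (auto simp: lookup_rees_exponent lookup_add lookup_sum lookup_single when_def)
  qed
qed

lemma push_rees_y_var: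
  assumes "CARD('n) \<ge> 2"
  shows "push_monom rees_exponent (y_var j) = (path_gen j * y_var 0 :: ('n::nontriv, 'k::field) T)"
  unfolding path_gen_eq[OF assms] x_interval_monom y_var_monom monom_poly_mult
  by (simp only: monom_poly_def push_monom_single rees_exponent_Y of_nat_0)

text \<open>
  Opposite paths cover the cycle exactly once, so both terms of \<open>h\<^sub>l\<close> go to \<open>x\<^sub>1 \<dots> x\<^sub>n t\<^sup>2\<close>.
\<close>
lemma push_rees_h_poly:
  assumes "even CARD('n)" "CARD('n) \<ge> 2" "l \<in> {1..CARD('n) div 2 - 1}"
  shows "push_monom rees_exponent (h_poly l :: ('n::nontriv, 'k::field) T) = 0"
proof -
  let ?m = "CARD('n) div 2"
  let ?x = "x_interval :: nat \<Rightarrow> nat \<Rightarrow> ('n, 'k) T"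
  have n: "?m + ?m = CARD('n)" using assms(1) by presburger
  have pair: "path_gen i * path_gen (i + ?m) = ?x 0 CARD('n)" if "i \<le> CARD('n)" for i
    using assms(2) n that by (simp add: path_gen_eq x_interval_concat x_interval_full_cycle add.assoc)
  have "push_monom rees_exponent (h_poly l :: ('n, 'k) T) =
      (path_gen l * path_gen (l + ?m)) * (y_var 0 * y_var 0) -
      (path_gen 0 * path_gen (0 + ?m)) * (y_var 0 * y_var 0)"
    using assms(2)
    by (simp add: h_poly_def push_monom_minus push_monom_mult rees_exponent_add push_rees_y_var mult_ac)
  also have "\<dots> = 0"
  proof -
    have "l \<le> CARD('n)" using assms(3) by auto
    then show ?thesis unfolding pair[OF \<open>l \<le> CARD('n)\<close>] pair[OF le0] by simp
  qed
  finally show ?thesis .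
qed

lemma L_plus_HT_in_rees_kernel:
  assumes "even CARD('n)" "CARD('n) \<ge> 2"
    and p: "p \<in> (L_ideal :: ('n::nontriv, 'k::field) T set)" and q: "q \<in> HT_ideal"
  shows "push_monom rees_exponent (p + q) = 0"
proof -
  let ?push = "push_monom rees_exponent :: ('n, 'k) T \<Rightarrow> ('n, 'k) T"
  have mult: "?push (r * s) = ?push r * ?push s" for r s
    by (rule push_monom_mult[OF rees_exponent_add])
  have "?push (\<Sum>i=1..CARD('n). a i * y_var i) = 0"
    if "\<forall>i\<in>{1..CARD('n)}. a i \<in> poly_ring (range X)" "(\<Sum>i=1..CARD('n). a i * path_gen i) = 0" for a
  proof -
    have "?push (\<Sum>i=1..CARD('n). a i * y_var i) = (\<Sum>i=1..CARD('n). a i * path_gen i * y_var 0)"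
      unfolding push_monom_sum mult
      by (rule sum.cong) (use that(1) assms(2) in \<open>auto simp: push_rees_X_part push_rees_y_var mult.assoc\<close>)
    then show ?thesis using that(2) by (simp flip: sum_distrib_right)
  qed
  then have "L_ideal \<subseteq> {p. ?push p = 0}"
    unfolding L_ideal_def sym_ideal_def
    by (intro ideal_gen_subset_push_kernel rees_exponent_add) blast
  moreover have "HT_ideal \<subseteq> {p. ?push p = 0}"
    unfolding HT_ideal_def H_ideal_def
    by (intro ideal_gen_subset_push_kernel rees_exponent_add)
       (use assms(1,2) in \<open>auto simp: push_monom_sum mult push_rees_h_poly\<close>)
  ultimately have "?push p = 0" "?push q = 0" using p q by auto
  then show ?thesis by (simp add: push_monom_add)
qed

section \<open>Leading monomials\<close>

lemma map_key_Y_sum: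
  "Poly_Mapping.map_key Y ((\<Sum>k\<in>A. single (X (e k)) 1) + u) = Poly_Mapping.map_key Y u"
  by (rule poly_mapping_eqI)
     (simp add: lookup_map_key_XY lookup_add lookup_sum lookup_single)

lemma map_key_Y_X_single:
  "Poly_Mapping.map_key Y (single (X i) c + u) = Poly_Mapping.map_key Y u"
  by (rule poly_mapping_eqI) (simp add: lookup_map_key_XY lookup_add lookup_single)

lemma map_key_Y_Y_single: "Poly_Mapping.map_key Y (single (Y i) c) = single i c"
  by (rule map_key_single) (rule inj_xy_var)

lemma monom_degree_single: "monom_degree (single i c) = c"
  by (simp add: monom_degree_def lookup_single when_def)

text \<open>
  Both monomials have degree one, and \<open>q\<close> is the last position where they differ.
\<close>
lemma revlex_variables:
  assumes "1 \<le> p" "p < q" "q \<le> CARD('n::nontriv)"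
  shows "revlex (single (of_nat q :: 'n mod_ring) 1) (single (of_nat p) 1)"
proof -
  have ne: "(of_nat p :: 'n mod_ring) \<noteq> of_nat i" if "i \<in> {q..CARD('n)}" for i
    using of_nat_mod_ring_inj[of p, where ?'n='n, of i] assms that by auto
  have ne': "(of_nat q :: 'n mod_ring) \<noteq> of_nat i" if "i \<in> {q<..CARD('n)}" for i
    using of_nat_mod_ring_inj[of q, where ?'n='n, of i] assms that by auto
  show ?thesis
    unfolding revlex_def using assms ne ne'
    by (intro disjI2 conjI bexI[of _ q]) (auto simp: monom_degree_single lookup_single)
qed

text \<open>
  Only the smaller product contains \<open>y\<^sub>0\<close>, which is the last variable, at position \<open>n\<close>.
\<close>
lemma revlex_opposite_pair:
  assumes "l \<in> {1..CARD('n) div 2 - 1}"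
  shows "revlex (single (of_nat 0 :: 'n::nontriv mod_ring) 1 + single (of_nat (CARD('n) div 2)) 1)
    (single (of_nat l) 1 + single (of_nat (l + CARD('n) div 2)) 1)"
proof -
  have ne: "(of_nat i :: 'n mod_ring) \<noteq> 0" if "i \<in> {1..<CARD('n)}" for i
    using of_nat_mod_ring_inj[of i "CARD('n)", where ?'n='n] that by auto
  have "l \<in> {1..<CARD('n)}" "l + CARD('n) div 2 \<in> {1..<CARD('n)}" "CARD('n) div 2 \<in> {1..<CARD('n)}"
    using assms by auto
  from this[THEN ne] show ?thesis
    unfolding revlex_def
    by (intro disjI2 conjI bexI[of _ "CARD('n)"])
       (auto simp: monom_degree_single monom_degree_add lookup_add lookup_single)
qed

text \<open>
  The two monomials of each \<open>f\<^sub>j\<close>, \<open>g\<^sub>k\<close>, \<open>h\<^sub>l\<close> already differ in their \<open>y\<close>-parts, so the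
  reverse lexicographic order decides.
\<close>
lemma generator_tail_less_lead:
  fixes lt2 :: "('n::nontriv mod_ring \<Rightarrow>\<^sub>0 nat) \<Rightarrow> _"
  assumes lt2: "monomial_order lt2"
  defines "lt \<equiv> product_order revlex lt2"
  shows "j \<in> {1..CARD('n) - 1} \<Longrightarrow>
      lt (single (X (of_nat j)) 1 + single (Y (of_nat (j + 1))) 1)
         (single (X (of_nat (CARD('n) div 2 + j))) 1 + single (Y (of_nat j)) 1)"
    and "k \<in> {1..CARD('n) div 2 - 1} \<Longrightarrow>
      lt ((\<Sum>i=CARD('n) div 2..<k + CARD('n) div 2. single (X (of_nat i)) 1)
            + single (Y (of_nat 0)) 1)
         ((\<Sum>i=0..<k. single (X (of_nat i)) 1) + single (Y (of_nat k)) 1)"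
    and "l \<in> {1..CARD('n) div 2 - 1} \<Longrightarrow>
      lt (single (Y (of_nat 0)) 1 + single (Y (of_nat (CARD('n) div 2))) 1)
         (single (Y (of_nat l)) 1 + single (Y (of_nat (l + CARD('n) div 2))) 1)"
proof -
  have ltI: "lt u v" if "revlex (Poly_Mapping.map_key Y u) (Poly_Mapping.map_key Y v)" for u v
    using that by (simp add: lt_def product_order_def)
  show "lt (single (X (of_nat j)) 1 + single (Y (of_nat (j + 1))) 1)
         (single (X (of_nat (CARD('n) div 2 + j))) 1 + single (Y (of_nat j)) 1)"
    if "j \<in> {1..CARD('n) - 1}"
    using that by (intro ltI, unfold map_key_Y_X_single map_key_Y_Y_single)
      (intro revlex_variables, auto)
  show "lt ((\<Sum>i=CARD('n) div 2..<k + CARD('n) div 2. single (X (of_nat i)) 1)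
            + single (Y (of_nat 0)) 1)
         ((\<Sum>i=0..<k. single (X (of_nat i)) 1) + single (Y (of_nat k)) 1)"
    if "k \<in> {1..CARD('n) div 2 - 1}"
  proof (rule ltI, unfold map_key_Y_sum map_key_Y_Y_single)
    have "k < CARD('n)" using that by auto
    then show "revlex (single (of_nat 0 :: 'n mod_ring) 1) (single (of_nat k) 1)"
      using revlex_variables[of k "CARD('n)", where ?'n='n] that by simp
  qed
  show "lt (single (Y (of_nat 0)) 1 + single (Y (of_nat (CARD('n) div 2))) 1)
         (single (Y (of_nat l)) 1 + single (Y (of_nat (l + CARD('n) div 2))) 1)"
    if "l \<in> {1..CARD('n) div 2 - 1}"
    by (rule ltI, unfold map_key_plus[OF inj_xy_var(2)] map_key_Y_Y_single) (rule revlex_opposite_pair[OF that])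
qed

section \<open>Standard monomials in the fibres of the Rees map\<close>

text \<open>
  The sum in the definition of \<open>rees_exponent\<close> runs through the same indices as \<open>window\<close>, in the
  opposite direction.
\<close>
lemma same_image_of_rees_exponent:
  fixes u v :: "'n::nontriv mod_ring xy_var \<Rightarrow>\<^sub>0 nat"
  assumes even: "even CARD('n)" and eq: "rees_exponent u = rees_exponent v"
  shows "same_image (CARD('n) div 2)
    (\<lambda>i. lookup u (X (of_nat i))) (\<lambda>i. lookup u (Y (of_nat i)))
    (\<lambda>i. lookup v (X (of_nat i))) (\<lambda>i. lookup v (Y (of_nat i)))"
proof -
  let ?m = "CARD('n) div 2"
  have n: "2 * ?m = CARD('n)" using even by simp
  have "CARD('n) = ?m + ?m" using n by simp
  then have n0: "(of_nat ?m + of_nat ?m :: 'n mod_ring) = 0"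
    by (metis of_nat_add of_nat_card_eq_0)
  have window: "window ?m (\<lambda>i. lookup w (Y (of_nat i))) i
      = (\<Sum>r<?m. lookup w (Y (of_nat i - of_nat r)))" for w :: "'n mod_ring xy_var \<Rightarrow>\<^sub>0 nat" and i
  proof -
    have "window ?m (\<lambda>i. lookup w (Y (of_nat i))) i
        = (\<Sum>r<?m. lookup w (Y (of_nat (i + ?m + 1 + (?m - Suc r)))))"
      unfolding window_def by (rule sum.nat_diff_reindex[symmetric])
    also have "\<dots> = (\<Sum>r<?m. lookup w (Y (of_nat i - of_nat r)))"
    proof (rule sum.cong[OF refl])
      fix r assume r: "r \<in> {..<?m}"
      then have "i + ?m + 1 + (?m - Suc r) + r = i + (?m + ?m)" by auto
      then have "(of_nat (i + ?m + 1 + (?m - Suc r)) + of_nat r :: 'n mod_ring) = of_nat i"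
        using n0 by (metis add.right_neutral of_nat_add)
      then show "lookup w (Y (of_nat (i + ?m + 1 + (?m - Suc r)))) = lookup w (Y (of_nat i - of_nat r))"
        by (simp only: flip: eq_diff_eq)
    qed
    finally show ?thesis .
  qed
  have total: "(\<Sum>j=1..CARD('n). lookup w (Y (of_nat j))) = (\<Sum>i\<in>UNIV. lookup w (Y i))"
    for w :: "'n mod_ring xy_var \<Rightarrow>\<^sub>0 nat"
  proof (rule sum.reindex_bij_betw)
    show "bij_betw (of_nat :: nat \<Rightarrow> 'n mod_ring) {1..CARD('n)} UNIV"
      unfolding bij_betw_def
    proof
      show "inj_on (of_nat :: nat \<Rightarrow> 'n mod_ring) {1..CARD('n)}"
        by (rule inj_onI) (rule of_nat_mod_ring_inj)
      show "(of_nat :: nat \<Rightarrow> 'n mod_ring) ` {1..CARD('n)} = UNIV"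
        by (metis UNIV_eq_I image_eqI mod_ring_index_cases)
    qed
  qed
  have "lookup u (X i) + (\<Sum>r<?m. lookup u (Y (i - of_nat r)))
      = lookup v (X i) + (\<Sum>r<?m. lookup v (Y (i - of_nat r)))" for i
    using eq by (simp flip: lookup_rees_exponent)
  moreover have "(\<Sum>i\<in>UNIV. lookup u (Y i)) = (\<Sum>i\<in>UNIV. lookup v (Y i))"
    using lookup_rees_exponent(2)[of u 0] lookup_rees_exponent(2)[of v 0] eq by simp
  ultimately show ?thesis
    unfolding same_image_def n window total by simp
qed

text \<open>
  All leading monomials are squarefree, so such a monomial does not divide \<open>u\<close> iff one of its
  variables is missing in \<open>u\<close>.
\<close>
lemma standard_monom_reduced_exponents:
  fixes u :: "'n::nontriv mod_ring xy_var \<Rightarrow>\<^sub>0 nat"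
    and lt2 :: "('n mod_ring \<Rightarrow>\<^sub>0 nat) \<Rightarrow> ('n mod_ring \<Rightarrow>\<^sub>0 nat) \<Rightarrow> bool"
  assumes n: "even CARD('n)" "CARD('n) \<ge> 4" and lt2: "monomial_order lt2"
    and std: "standard_monom (product_order revlex lt2)
      (f_poly ` {1..CARD('n) - 1} \<union> g_poly ` {1..CARD('n) div 2 - 1}
        \<union> h_poly ` {1..CARD('n) div 2 - 1} :: ('n, 'k::field) T set) u"
  shows "reduced_exponents (CARD('n) div 2)
    (\<lambda>i. lookup u (X (of_nat i))) (\<lambda>i. lookup u (Y (of_nat i)))"
proof -
  let ?m = "CARD('n) div 2"
  let ?lt = "product_order revlex lt2"
  let ?a = "\<lambda>i. lookup u (X (of_nat i))" and ?b = "\<lambda>i. lookup u (Y (of_nat i))"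
  have m: "2 * ?m = CARD('n)" using n by simp
  have lt: "monomial_order ?lt" by (rule monomial_order_product[OF monomial_order_revlex lt2])
  note lead = lead_monom_binomial(2)[OF lt, where ?'k='k]
  have small: "\<exists>v. lookup u v < lookup (lead_monom ?lt g) v"
    if "g \<in> f_poly ` {1..CARD('n) - 1} \<union> g_poly ` {1..?m - 1} \<union> h_poly ` {1..?m - 1}"
    for g :: "('n, 'k) T"
    using std that unfolding standard_monom_def by blast
  have F: "?b j = 0 \<or> ?a (?m + j) = 0" if j: "j \<in> {1..CARD('n) - 1}" for j
  proof -
    have lead_eq: "lead_monom ?lt (f_poly j :: ('n, 'k) T) =
        single (X (of_nat (?m + j))) 1 + single (Y (of_nat j)) 1"
      unfolding f_poly_binomial by (rule lead[OF generator_tail_less_lead(1)[OF lt2 j]])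
    have "(f_poly j :: ('n, 'k) T) \<in> f_poly ` {1..CARD('n) - 1}"
      using j by (rule imageI)
    then have "\<exists>v. lookup u v < lookup (lead_monom ?lt (f_poly j :: ('n, 'k) T)) v"
      by (intro small) blast
    then obtain v where "lookup u v <
        lookup (single (X (of_nat (?m + j))) 1 + single (Y (of_nat j)) 1) v"
      unfolding lead_eq by blast
    then show ?thesis
      by (cases v) (auto simp: lookup_add lookup_single when_def split: if_splits)
  qed
  have G: "?b k = 0 \<or> (\<exists>i<k. ?a i = 0)" if k: "k \<in> {1..?m - 1}" for k
  proof -
    have k1: "k \<ge> 1" using k by simp
    have lead_eq: "lead_monom ?lt (g_poly k :: ('n, 'k) T) =
        (\<Sum>i=0..<k. single (X (of_nat i)) 1) + single (Y (of_nat k)) 1"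
      unfolding g_poly_binomial[OF k1] by (rule lead[OF generator_tail_less_lead(2)[OF lt2 k]])
    have "(g_poly k :: ('n, 'k) T) \<in> g_poly ` {1..?m - 1}"
      using k by (rule imageI)
    then have "\<exists>v. lookup u v < lookup (lead_monom ?lt (g_poly k :: ('n, 'k) T)) v"
      by (intro small) blast
    then obtain v where v: "lookup u v <
        lookup ((\<Sum>i=0..<k. single (X (of_nat i)) 1) + single (Y (of_nat k)) 1) v"
      unfolding lead_eq by blast
    show ?thesis
    proof (cases v)
      case (Y i)
      then show ?thesis using v
        by (auto simp: lookup_add lookup_sum lookup_single when_def split: if_splits)
    next
      case (X i)
      have inj: "inj_on (of_nat :: nat \<Rightarrow> 'n mod_ring) {0..<k}"
      proof (rule inj_onI)
        fix p q assume pq: "p \<in> {0..<k}" "q \<in> {0..<k}" "(of_nat p :: 'n mod_ring) = of_nat q"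
        have "p < CARD('n)" "q < CARD('n)" using pq k by auto
        then show "p = q" using pq(3) by (simp add: of_nat_mod_ring_eq_iff)
      qed
      have "lookup u v < (\<Sum>p=0..<k. if of_nat p = i then 1 else 0)"
        using v X by (simp add: lookup_add lookup_sum lookup_single when_def cong: if_cong)
      also have "\<dots> = (\<Sum>p\<in>of_nat ` {0..<k}. if p = i then 1 else 0)"
        by (simp add: sum.reindex[OF inj])
      also have "\<dots> = (if i \<in> of_nat ` {0..<k} then 1 else 0)" by simp
      finally show ?thesis using X by (auto split: if_splits)
    qed
  qed
  have H: "?b l = 0 \<or> ?b (?m + l) = 0" if l: "l \<in> {1..?m - 1}" for l
  proof -
    have "l \<in> {1..CARD('n)}" "l + ?m \<in> {1..CARD('n)}" "l \<noteq> l + ?m"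
      using l m by auto
    then have ne: "(of_nat l :: 'n mod_ring) \<noteq> of_nat (l + ?m)"
      using of_nat_mod_ring_inj by blast
    have lead_eq: "lead_monom ?lt (h_poly l :: ('n, 'k) T) =
        single (Y (of_nat l)) 1 + single (Y (of_nat (l + ?m))) 1"
      unfolding h_poly_binomial by (rule lead[OF generator_tail_less_lead(3)[OF lt2 l]])
    have "(h_poly l :: ('n, 'k) T) \<in> h_poly ` {1..?m - 1}"
      using l by (rule imageI)
    then have "\<exists>v. lookup u v < lookup (lead_monom ?lt (h_poly l :: ('n, 'k) T)) v"
      by (intro small) blast
    then obtain v where "lookup u v <
        lookup (single (Y (of_nat l)) 1 + single (Y (of_nat (l + ?m))) 1) v"
      unfolding lead_eq by blast
    then show ?thesis using ne
      by (cases v) (auto simp: lookup_add lookup_single when_def add.commute split: if_splits)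
  qed
  \<comment> \<open>For \<open>f\<^sub>j\<close> with \<open>j \<ge> m\<close> the index \<open>m + j\<close> runs past \<open>n\<close>.\<close>
  have wrap: "?a (?m + (?m + j)) = ?a j" for j
  proof -
    have "?m + (?m + j) = j + CARD('n)" using m by simp
    then have "(of_nat (?m + (?m + j)) :: 'n mod_ring) = of_nat j"
      by (simp only: of_nat_add[of j] of_nat_card_eq_0 add_0_right)
    then show ?thesis by (simp only:)
  qed
  have range: "k \<in> {1..?m - 1}" if "k \<in> {1..<?m}" for k
    using that unfolding atLeastAtMost_iff atLeastLessThan_iff by linarith
  show ?thesis
    unfolding reduced_exponents_def
  proof (intro conjI ballI impI)
    fix j assume "j \<in> {1..<?m}"
    then have j: "j \<in> {1..CARD('n) - 1}" "?m + j \<in> {1..CARD('n) - 1}" using m by auto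
    show "?a (?m + j) = 0" if "?b j > 0"
      using that F[OF j(1)] by linarith
    show "?a j = 0" if "?b (?m + j) > 0"
      using that F[OF j(2)] unfolding wrap by linarith
  next
    show "?a 0 = 0" if "?b ?m > 0"
    proof -
      have "?m \<in> {1..CARD('n) - 1}" using n m by auto
      from F[OF this] that show ?thesis using wrap[of 0] unfolding add_0_right by linarith
    qed
  next
    fix k assume k: "k \<in> {1..<?m}" and pos: "?b k > 0"
    from G[OF range[OF k]] show "\<exists>i<k. ?a i = 0"
      using pos by (metis less_irrefl)
  next
    fix l assume l: "l \<in> {1..<?m}"
    show "?b l = 0 \<or> ?b (?m + l) = 0" by (rule H[OF range[OF l]])
  qed
qed

theorem theorem5p2:
  fixes lt2 :: "('n::nontriv mod_ring \<Rightarrow>\<^sub>0 nat) \<Rightarrow> ('n mod_ring \<Rightarrow>\<^sub>0 nat) \<Rightarrow> bool"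
    and lt :: "('n mod_ring xy_var \<Rightarrow>\<^sub>0 nat) \<Rightarrow> ('n mod_ring xy_var \<Rightarrow>\<^sub>0 nat) \<Rightarrow> bool"
    and n :: nat
  assumes "n = CARD('n)" and "n \<ge> 4" and "even n"
    and "monomial_order lt2"
    and "lt = product_order revlex lt2"
  shows "is_groebner_basis lt
           (f_poly ` {1..n - 1} \<union> g_poly ` {1..n div 2 - 1} \<union> h_poly ` {1..n div 2 - 1}
              :: ('n, 'k::field) T set)
           {p + q | p q. p \<in> L_ideal \<and> q \<in> HT_ideal}"
proof -
  let ?G = "f_poly ` {1..CARD('n) - 1} \<union> g_poly ` {1..CARD('n) div 2 - 1}
    \<union> h_poly ` {1..CARD('n) div 2 - 1} :: ('n, 'k) T set"
  let ?I = "{p + q | p q. p \<in> L_ideal \<and> q \<in> HT_ideal} :: ('n, 'k) T set"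
  have n: "even CARD('n)" "CARD('n) \<ge> 4" "CARD('n) \<ge> 2" "CARD('n) div 2 > 0"
    and m: "2 * (CARD('n) div 2) = CARD('n)"
    using assms(1-3) by auto
  have zero: "0 \<in> (L_ideal :: ('n, 'k) T set)" "0 \<in> (HT_ideal :: ('n, 'k) T set)"
    unfolding L_ideal_def sym_ideal_def HT_ideal_def
    by (rule module.span_zero[OF module_times])+
  have "is_groebner_basis lt ?G ?I"
  proof (rule groebner_basis_by_fibres[where \<psi> = rees_exponent])
    show "monomial_order lt"
      unfolding assms(5) by (rule monomial_order_product[OF monomial_order_revlex assms(4)])
    show "rees_exponent (u + v) = rees_exponent u + rees_exponent v"
      for u v :: "'n mod_ring xy_var \<Rightarrow>\<^sub>0 nat"
      by (rule rees_exponent_add)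
    show "finite {v. rees_exponent v = rees_exponent u}" for u :: "'n mod_ring xy_var \<Rightarrow>\<^sub>0 nat"
      by (rule finite_rees_fibre)
    show "finite ?G" by simp
    show "?G \<subseteq> ?I"
    proof
      fix p assume "p \<in> ?G"
      then have "p \<in> L_ideal \<or> p \<in> HT_ideal"
        using f_poly_in_L n(3) g_poly_in_L h_poly_in_HT by blast
      then show "p \<in> ?I" using zero by force
    qed
    show "push_monom rees_exponent p = 0" if "p \<in> ?I" for p
      using that L_plus_HT_in_rees_kernel[OF n(1,3)] by blast
    show "\<exists>a b. g = monom_poly a - monom_poly b \<and> lt b a" if "g \<in> ?G" for g
      using that
    proof (elim UnE imageE)
      fix j assume "g = f_poly j" "j \<in> {1..CARD('n) - 1}"
      then show ?thesis
        using f_poly_binomial generator_tail_less_lead(1)[OF assms(4)] assms(5) by blast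
    next
      fix k assume k: "g = g_poly k" "k \<in> {1..CARD('n) div 2 - 1}"
      then have "k \<ge> 1" by simp
      with k show ?thesis
        using g_poly_binomial generator_tail_less_lead(2)[OF assms(4)] assms(5) by blast
    next
      fix l assume "g = h_poly l" "l \<in> {1..CARD('n) div 2 - 1}"
      then show ?thesis
        using h_poly_binomial generator_tail_less_lead(3)[OF assms(4)] assms(5) by blast
    qed
    show "u = v" if eq: "rees_exponent u = rees_exponent v"
      and std: "standard_monom lt ?G u" "standard_monom lt ?G v" for u v
    proof (rule poly_mapping_eqI)
      fix w
      have agree: "lookup u (X (of_nat i)) = lookup v (X (of_nat i)) \<and>
          lookup u (Y (of_nat i)) = lookup v (Y (of_nat i))" if "i < CARD('n)" for i
        using reduced_exponents_unique[OF same_image_of_rees_exponent[OF n(1) eq]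
            standard_monom_reduced_exponents[OF n(1,2) assms(4) std(1)[unfolded assms(5)]]
            standard_monom_reduced_exponents[OF n(1,2) assms(4) std(2)[unfolded assms(5)]]
            n(4), of i] that m by simp
      have index: "\<exists>k<CARD('n). i = of_nat k" for i :: "'n mod_ring"
      proof -
        obtain k where "i = of_nat k" by (rule mod_ring_index_cases)
        then have "i = of_nat (k mod CARD('n))" by (simp add: of_nat_mod_ring_eq_iff)
        then show ?thesis using n(3) by (intro exI[of _ "k mod CARD('n)"]) simp
      qed
      show "lookup u w = lookup v w"
        by (cases w) (use agree index in metis)+
    qed
  qed
  then show ?thesis using assms(1) by simp
qed

end
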